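(* The following hold for all integers $n\geq 0$: (1) $pl_{4}(4n+3)\equiv 0\pmod{2}$; (2) $pl_{4}(4n)\equiv pl_{4}(4n+1)\equiv pl_{4}(4n+2)\pmod{2}$; (3) $pl_{8}(8n)+pl_{8}(8n+1) \equiv pl_{8}(8n+3)\pmod{2}$; (4) $pl_{8}(8n+5)\equiv pl_{8}(8n+6) \equiv pl_{8}(8n+7)\equiv 0 \pmod{2}$; (5) $pl_{9}(9n+1)\equiv pl_{9}(9n+8)\pmod{3}$.
   Context: A plane partition of a positive integer $n$ is a two-dimensional array of positive integers $n_{i,j}$ ($i$ the row index, $j$ the column index) summing to $n$, whose shape is the (left-justified) Ferrers diagram of a partition, and whose entries are non-increasing from left to right along rows and from top to bottom along columns. For a positive integer $r$, $pl_r(n)$ denotes the number of plane partitions of $n$ with at most $r$ rows, with the convention $pl_r(0)=1$. *)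

theory Defs
  imports "HOL-Number_Theory.Cong"
begin

text \<open>
  A plane partition is represented by the list of its rows.  All rows are nonempty and
  row lengths are non-increasing, so the shape is a left-justified Ferrers diagram
  and \<^term>\<open>length P\<close> is the number of rows.
\<close>

definition plane_partition :: "nat list list \<Rightarrow> bool" where
  "plane_partition P \<longleftrightarrow>
     (\<forall>row \<in> set P. row \<noteq> []) \<and>
     sorted_wrt (\<ge>) (map length P) \<and>
     (\<forall>row \<in> set P. \<forall>x \<in> set row. 0 < x) \<and>
     (\<forall>row \<in> set P. sorted_wrt (\<ge>) row) \<and>
     (\<forall>i j. Suc i < length P \<and> j < length (P ! Suc i) \<longrightarrow> P ! Suc i ! j \<le> P ! i ! j)"

definition plane_partitions :: "nat \<Rightarrow> nat \<Rightarrow> nat list list set" where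
  "plane_partitions r n =
     {P. plane_partition P \<and> length P \<le> r \<and> sum_list (map sum_list P) = n}"

definition pl :: "nat \<Rightarrow> nat \<Rightarrow> nat" where
  "pl r n = card (plane_partitions r n)"

text \<open>\<^const>\<open>card\<close> is meaningful in the definition of \<^const>\<open>pl\<close>: the sets are finite.\<close>

lemma length_le_sum_list_pos:
  assumes "\<forall>x \<in> set xs. 0 < (x::nat)"
  shows "length xs \<le> sum_list xs"
  using assms by (induction xs) auto

lemma finite_plane_partitions: "finite (plane_partitions r n)"
proof -
  let ?R = "{row. set row \<subseteq> {..n} \<and> length row \<le> n}"
  have "row \<in> ?R" if P: "P \<in> plane_partitions r n" and row: "row \<in> set P" for P row
  proof -
    have "sum_list row \<le> n"
      using P row member_le_sum_list[of "sum_list row" "map sum_list P"]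
      by (auto simp: plane_partitions_def)
    moreover have "length row \<le> sum_list row"
      using P row by (intro length_le_sum_list_pos)
        (auto simp: plane_partitions_def plane_partition_def)
    moreover have "x \<le> sum_list row" if "x \<in> set row" for x
      using that by (simp add: member_le_sum_list)
    ultimately show ?thesis by fastforce
  qed
  then have "plane_partitions r n \<subseteq> {P. set P \<subseteq> ?R \<and> length P \<le> r}"
    unfolding plane_partitions_def by blast
  moreover have "finite {P. set P \<subseteq> ?R \<and> length P \<le> r}"
    by (intro finite_lists_length_le) simp
  ultimately show ?thesis by (rule finite_subset)
qed

text \<open>The convention for \<open>n = 0\<close> holds because only the empty array is counted.\<close>

lemma pl_0: "pl r 0 = 1"
proof -
  have "P = []" if "P \<in> plane_partitions r 0" for P
  proof (cases P)
    case (Cons row P')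
    then show ?thesis
      using that by (cases row) (auto simp: plane_partitions_def plane_partition_def)
  qed
  then have "plane_partitions r 0 = {[]}"
    by (auto simp: plane_partitions_def plane_partition_def)
  then show ?thesis by (simp add: pl_def)
qed

end

theory Submission
  imports Defs "HOL-Library.More_List" "HOL-Computational_Algebra.Formal_Power_Series"
begin

text \<open>
  The diagonals of a plane partition with at most \<open>r\<close> rows form two chains of interlacing
  partitions that meet in the main diagonal \<open>p\<close>, so the generating function is the sum over \<open>p\<close>
  of a product of two principally specialised Schur functions.  Cauchy's identity (from
  Pieri's rule, which in turn comes from toggling a middle partition) evaluates the sum,
  for plane partitions with at most \<open>r\<close> rows and \<open>m\<close> columns, as the product of
  \<open>1 / (1 - X ^ (i + j + 1))\<close> over \<open>i < r\<close> and \<open>j < m\<close>.  Letting \<open>m\<close> grow, the series of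
  \<open>pl r\<close> is a polynomial, the product of \<open>(1 - X ^ k) ^ (r - k)\<close> over \<open>k < r\<close>, divided by the
  \<open>r\<close>-th power of Euler's product.  For \<open>r\<close> a power of the prime \<open>q\<close>, modulo \<open>q\<close> that
  \<open>r\<close>-th power is a series in \<open>X ^ r\<close>, so linear relations between residue classes modulo \<open>r\<close>
  of the coefficients can be read off from the polynomial.
\<close>

unbundle fps_syntax

section \<open>Interlacing partitions and toggles\<close>

text \<open>Partitions are encoded as sequences padded with zeros, so no length has to be tracked. A
  sum over an infinite set is 0, which is why finite support is carried along as a hypothesis
  below.\<close>

definition psize :: "(nat \<Rightarrow> nat) \<Rightarrow> nat" where
  "psize p = (\<Sum>i | p i \<noteq> 0. p i)"

text \<open>This is the chain \<open>q 0 >= p 0 >= q 1 >= p 1 >= ...\<close>, that is, the skew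
  shape \<open>q / p\<close> is a horizontal strip. It forces both sequences to be
  non-increasing.\<close>

definition interlaces :: "(nat \<Rightarrow> nat) \<Rightarrow> (nat \<Rightarrow> nat) \<Rightarrow> bool" where
  "interlaces p q \<longleftrightarrow> (\<forall>i. p i \<le> q i \<and> q (Suc i) \<le> p i)"

lemma interlacesD:
  assumes "interlaces p q"
  shows "p i \<le> q i" "q (Suc i) \<le> p i"
  using assms by (auto simp: interlaces_def)

lemma psize_eq_sum:
  assumes "finite A" "\<And>i. i \<notin> A \<Longrightarrow> p i = 0"
  shows "psize p = sum p A"
  unfolding psize_def
proof (rule sum.mono_neutral_left)
  show "{i. p i \<noteq> 0} \<subseteq> A"
    using assms(2) by (metis (mono_tags) mem_Collect_eq subsetI)
qed (simp_all add: assms(1))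

lemma psize_0: "psize (\<lambda>_. 0) = 0"
  by (simp add: psize_def)

lemma le_psize:
  assumes "finite {i. p i \<noteq> 0}"
  shows "p i \<le> psize p"
proof (cases "p i = 0")
  case False
  then show ?thesis
    unfolding psize_def using assms by (intro member_le_sum) auto
qed simp

lemma psize_mono:
  assumes "finite {i. q i \<noteq> 0}" "\<And>i. p i \<le> q i"
  shows "psize p \<le> psize q"
proof -
  have "psize p = sum p {i. q i \<noteq> 0}"
  proof (rule psize_eq_sum[OF assms(1)])
    show "p i = 0" if "i \<notin> {i. q i \<noteq> 0}" for i
      using that assms(2)[of i] by simp
  qed
  also have "\<dots> \<le> psize q"
    unfolding psize_def by (intro sum_mono assms)
  finally show ?thesis .
qed

lemma finite_support_iff_eventually_0:
  fixes p :: "nat \<Rightarrow> nat"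
  shows "finite {i. p i \<noteq> 0} \<longleftrightarrow> (\<exists>L. \<forall>i\<ge>L. p i = 0)"
proof
  assume fin: "finite {i. p i \<noteq> 0}"
  obtain L where "\<forall>i\<in>{i. p i \<noteq> 0}. i < L"
    using iffD1[OF finite_nat_set_iff_bounded fin] by blast
  then have "p i = 0" if "L \<le> i" for i
    using that by fastforce
  then show "\<exists>L. \<forall>i\<ge>L. p i = 0" by blast
next
  assume "\<exists>L. \<forall>i\<ge>L. p i = 0"
  then obtain L where "\<forall>i\<ge>L. p i = 0" ..
  then have "i < L" if "p i \<noteq> 0" for i
    using that by (cases "i < L") simp_all
  then show "finite {i. p i \<noteq> 0}"
    unfolding finite_nat_set_iff_bounded by blast
qed

lemma interlaces_finite_lower:
  assumes "interlaces p q" "finite {i. q i \<noteq> 0}"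
  shows "finite {i. p i \<noteq> 0}"
proof -
  have "q i \<noteq> 0" if "p i \<noteq> 0" for i
    using that interlacesD(1)[OF assms(1), of i] by simp
  then have "{i. p i \<noteq> 0} \<subseteq> {i. q i \<noteq> 0}" by blast
  then show ?thesis using assms(2) by (rule finite_subset)
qed

text \<open>The upper partition has at most one part more, so the bound on the support moves from
  \<open>L\<close> to \<open>Suc L\<close>.\<close>

lemma interlaces_finite_upper:
  assumes "interlaces p q" "finite {i. p i \<noteq> 0}"
  shows "finite {i. q i \<noteq> 0}"
proof -
  obtain L where L: "\<forall>i\<ge>L. p i = 0"
    using assms(2) finite_support_iff_eventually_0 by blast
  have "q i = 0" if "i \<ge> Suc L" for i
    using that L interlacesD(2)[OF assms(1), of "i - 1"] by (cases i) auto
  then show ?thesis using finite_support_iff_eventually_0 by blast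
qed

lemma interlaces_psize_le:
  assumes "interlaces p q" "finite {i. q i \<noteq> 0}"
  shows "psize p \<le> psize q"
  using assms by (intro psize_mono) (auto simp: interlaces_def)

lemma finite_bounded_functions:
  "finite {p :: nat \<Rightarrow> nat. \<forall>i. p i \<le> B \<and> (L \<le> i \<longrightarrow> p i = 0)}"
proof -
  have "finite {p :: nat \<Rightarrow> nat. \<forall>i. (i \<in> {..<L} \<longrightarrow> p i \<in> {..B}) \<and> (i \<notin> {..<L} \<longrightarrow> p i = 0)}"
    by (rule finite_set_of_finite_funs) auto
  then show ?thesis by (rule rev_finite_subset) auto
qed

lemma finite_interlacing_lower:
  assumes "finite {i. q i \<noteq> 0}"
  shows "finite {p. interlaces p q}"
proof -
  obtain L where L: "\<forall>i\<ge>L. q i = 0"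
    using assms finite_support_iff_eventually_0 by blast
  have "{p. interlaces p q} \<subseteq> {p. \<forall>i. p i \<le> psize q \<and> (L \<le> i \<longrightarrow> p i = 0)}"
  proof (clarsimp, intro conjI impI)
    fix p i assume p: "interlaces p q"
    show "p i \<le> psize q"
      using interlacesD(1)[OF p, of i] le_psize[OF assms, of i] by linarith
    show "p i = 0" if "L \<le> i"
      using interlacesD(1)[OF p, of i] L that by simp
  qed
  then show ?thesis by (rule finite_subset) (rule finite_bounded_functions)
qed

text \<open>Interlacing with \<open>p\<close> bounds every part of \<open>q\<close> except
  \<open>q 0\<close>; fixing the size bounds that one too.\<close>

lemma finite_interlacing_upper:
  assumes "finite {i. p i \<noteq> 0}"
  shows "finite {q. interlaces p q \<and> psize q = n}"
proof -
  obtain L where L: "\<forall>i\<ge>L. p i = 0"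
    using assms finite_support_iff_eventually_0 by blast
  have "q i = 0" if "interlaces p q" "i \<ge> Suc L" for q i
    using that L interlacesD(2)[OF that(1), of "i - 1"] by (cases i) auto
  moreover have "q i \<le> psize q" if "interlaces p q" for q i
    using le_psize interlaces_finite_upper that assms by blast
  ultimately have "{q. interlaces p q \<and> psize q = n} \<subseteq>
      {q. \<forall>i. q i \<le> n \<and> (Suc L \<le> i \<longrightarrow> q i = 0)}"
    by auto
  then show ?thesis by (rule finite_subset) (rule finite_bounded_functions)
qed

text \<open>The piecewise-linear toggle: for fixed \<open>p\<close> and \<open>q\<close>, both \<open>u (Suc i)\<close> for \<open>u\<close> above
  and \<open>k i\<close> for \<open>k\<close> below range over the interval from \<open>max (p (Suc i)) (q (Suc i))\<close> to
  \<open>min (p i) (q i)\<close>; reflecting this interval exchanges the two.\<close>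

definition toggle_up :: "(nat \<Rightarrow> nat) \<Rightarrow> (nat \<Rightarrow> nat) \<Rightarrow> nat \<Rightarrow> (nat \<Rightarrow> nat) \<Rightarrow> nat \<Rightarrow> nat" where
  "toggle_up p q t k i = (case i of 0 \<Rightarrow> max (p 0) (q 0) + t
     | Suc j \<Rightarrow> min (p j) (q j) + max (p (Suc j)) (q (Suc j)) - k j)"

definition toggle_down :: "(nat \<Rightarrow> nat) \<Rightarrow> (nat \<Rightarrow> nat) \<Rightarrow> (nat \<Rightarrow> nat) \<Rightarrow> nat \<Rightarrow> nat" where
  "toggle_down p q u i = min (p i) (q i) + max (p (Suc i)) (q (Suc i)) - u (Suc i)"

text \<open>The reflection maps the interval to itself. Since \<open>k i\<close> lies in it, the
  truncated subtraction in \<open>toggle_up\<close> is exact.\<close>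

lemma toggle_up_interlaces:
  assumes "interlaces k p" "interlaces k q"
  shows "interlaces p (toggle_up p q t k)" "interlaces q (toggle_up p q t k)"
proof -
  have "max (p (Suc i)) (q (Suc i)) \<le> k i" "k i \<le> min (p i) (q i)" for i
    using assms by (auto simp: interlaces_def)
  note k = this
  have "max (p i) (q i) \<le> toggle_up p q t k i" for i
  proof (cases i)
    case (Suc j)
    then show ?thesis using k(2)[of j] unfolding toggle_up_def Suc nat.case by linarith
  qed (simp add: toggle_up_def)
  moreover have "toggle_up p q t k (Suc i) \<le> min (p i) (q i)" for i
    using k[of i] unfolding toggle_up_def nat.case by linarith
  ultimately have *: "max (p i) (q i) \<le> toggle_up p q t k i \<and> toggle_up p q t k (Suc i) \<le> min (p i) (q i)" for i
    by blast
  from *[unfolded max.bounded_iff min.bounded_iff]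
  show "interlaces p (toggle_up p q t k)" "interlaces q (toggle_up p q t k)"
    by (auto simp: interlaces_def)
qed

lemma toggle_down_interlaces:
  assumes "interlaces p u" "interlaces q u"
  shows "interlaces (toggle_down p q u) p" "interlaces (toggle_down p q u) q"
proof -
  have *: "max (p (Suc i)) (q (Suc i)) \<le> u (Suc i)" "u (Suc i) \<le> min (p i) (q i)" for i
    using assms by (auto simp: interlaces_def)
  have "max (p (Suc i)) (q (Suc i)) \<le> toggle_down p q u i \<and> toggle_down p q u i \<le> min (p i) (q i)" for i
    using *[of i] unfolding toggle_down_def by linarith
  from this[unfolded max.bounded_iff min.bounded_iff]
  show "interlaces (toggle_down p q u) p" "interlaces (toggle_down p q u) q"
    by (auto simp: interlaces_def)
qed

lemma toggle_down_up:
  assumes "interlaces k p" "interlaces k q"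
  shows "toggle_down p q (toggle_up p q t k) = k"
proof
  fix i
  have "k i \<le> min (p i) (q i)" using assms by (auto simp: interlaces_def)
  then show "toggle_down p q (toggle_up p q t k) i = k i"
    unfolding toggle_down_def toggle_up_def nat.case by linarith
qed

text \<open>\<open>u 0\<close> is bounded only from below and has no partner in the lower partition.
  Its excess \<open>t\<close> over \<open>max (p 0) (q 0)\<close> is the extra datum that makes the
  toggle invertible.\<close>

lemma toggle_up_down:
  assumes "interlaces p u" "interlaces q u" "t = u 0 - max (p 0) (q 0)"
  shows "toggle_up p q t (toggle_down p q u) = u"
proof
  fix i
  have *: "max (p i) (q i) \<le> u i" "u (Suc i) \<le> min (p i) (q i)" for i
    using assms by (auto simp: interlaces_def)
  show "toggle_up p q t (toggle_down p q u) i = u i"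
  proof (cases i)
    case 0
    then show ?thesis using *(1)[of 0] assms(3) unfolding toggle_up_def by simp
  next
    case (Suc j)
    then show ?thesis using *(2)[of j]
      unfolding toggle_up_def toggle_down_def Suc nat.case by linarith
  qed
qed

text \<open>Each \<open>k i\<close> and its reflection \<open>u (Suc i)\<close> add up to the sum of
  the endpoints of their interval. In total the maxima and minima recombine by
  \<open>max a b + min a b = a + b\<close>, and \<open>u 0\<close> leaves over
  \<open>t\<close>.\<close>

lemma psize_toggle_up:
  assumes "interlaces k p" "interlaces k q" "finite {i. k i \<noteq> 0}"
  shows "psize (toggle_up p q t k) + psize k = psize p + psize q + t"
proof -
  let ?u = "toggle_up p q t k"
  have fin: "finite {i. p i \<noteq> 0}" "finite {i. q i \<noteq> 0}"
    using assms interlaces_finite_upper by blast+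
  obtain L1 where L1: "\<forall>i\<ge>L1. p i = 0"
    using fin(1) finite_support_iff_eventually_0 by blast
  obtain L2 where L2: "\<forall>i\<ge>L2. q i = 0"
    using fin(2) finite_support_iff_eventually_0 by blast
  define L where "L = max L1 L2"
  have L: "p i = 0" "q i = 0" "k i = 0" if "i \<ge> L" for i
    using that L1 L2 interlacesD(1)[OF assms(1), of i] by (auto simp: L_def)
  have u: "interlaces p ?u" by (rule toggle_up_interlaces) (use assms in auto)
  have Lu: "?u i = 0" if "i \<ge> Suc L" for i
    using that L interlacesD(2)[OF u, of "i - 1"] by (cases i) auto
  have *: "?u (Suc i) + k i = min (p i) (q i) + max (p (Suc i)) (q (Suc i))" for i
    using assms(1,2) unfolding toggle_up_def nat.case
    by (intro le_add_diff_inverse2) (auto simp: interlaces_def intro: trans_le_add1)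
  have "psize ?u + psize k = sum ?u {..<Suc L} + sum k {..<L}"
    using L Lu by (subst (1) psize_eq_sum[of "{..<Suc L}"], simp, simp add: not_less Suc_le_eq,
        subst (1) psize_eq_sum[of "{..<L}" k]) auto
  also have "\<dots> = ?u 0 + (\<Sum>i<L. ?u (Suc i) + k i)"
    by (subst sum.lessThan_Suc_shift) (simp add: sum.distrib)
  also have "\<dots> = t + (max (p 0) (q 0) + (\<Sum>i<L. max (p (Suc i)) (q (Suc i)))) + (\<Sum>i<L. min (p i) (q i))"
    unfolding * by (simp add: sum.distrib toggle_up_def)
  \<comment> \<open>The maximum at index 0 completes the shifted maxima; the new last index
    \<open>L\<close> contributes 0.\<close>
  also have "max (p 0) (q 0) + (\<Sum>i<L. max (p (Suc i)) (q (Suc i))) = (\<Sum>i<Suc L. max (p i) (q i))"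
    by (subst sum.lessThan_Suc_shift) simp
  also have "\<dots> = (\<Sum>i<L. max (p i) (q i))"
    using L by simp
  also have "t + (\<Sum>i<L. max (p i) (q i)) + (\<Sum>i<L. min (p i) (q i)) = t + (\<Sum>i<L. max (p i) (q i) + min (p i) (q i))"
    by (simp add: sum.distrib)
  also have "(\<Sum>i<L. max (p i) (q i) + min (p i) (q i)) = (\<Sum>i<L. p i + q i)"
    by (intro sum.cong) auto
  also have "\<dots> = psize p + psize q"
    using L by (subst (1 2) psize_eq_sum[of "{..<L}"]) (auto simp: sum.distrib)
  finally show ?thesis by simp
qed

section \<open>Schur functions, Pieri's rule and Cauchy's identity\<close>

text \<open>The Schur polynomial of \<open>q\<close> by the branching rule: each variable removes
  one horizontal strip and is raised to the size of that strip.\<close>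

primrec schur :: "'a::comm_ring_1 list \<Rightarrow> (nat \<Rightarrow> nat) \<Rightarrow> 'a" where
  "schur [] q = (if q = (\<lambda>_. 0) then 1 else 0)"
| "schur (x # xs) q = (\<Sum>p | interlaces p q. x ^ (psize q - psize p) * schur xs p)"

text \<open>The complete homogeneous symmetric polynomial of degree \<open>k\<close>;
  \<open>t\<close> is the exponent of the first variable.\<close>

primrec hsym :: "'a::comm_ring_1 list \<Rightarrow> nat \<Rightarrow> 'a" where
  "hsym [] k = (if k = 0 then 1 else 0)"
| "hsym (x # xs) k = (\<Sum>t\<le>k. x ^ t * hsym xs (k - t))"

text \<open>Induction on the variables. Expanding \<open>schur (x # xs) u\<close> gives paths from
  \<open>q\<close> up to \<open>u\<close> and down to \<open>p\<close>. The toggle turns them into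
  paths down to \<open>l\<close> and up to \<open>p\<close>, together with a number
  \<open>t\<close>. The sum over \<open>p\<close> is then the induction hypothesis at
  \<open>l\<close>, and \<open>t\<close> supplies the exponent of \<open>x\<close> in
  \<open>hsym\<close>.\<close>

lemma pieri:
  assumes "finite {i. q i \<noteq> 0}"
  shows "(\<Sum>u | interlaces q u \<and> psize u = psize q + k. schur xs u) = hsym xs k * schur xs q"
  using assms
proof (induction xs arbitrary: q k)
  case Nil
  have 1: "interlaces q (\<lambda>_. 0) \<longleftrightarrow> q = (\<lambda>_. 0)"
    by (auto simp: interlaces_def)
  have "(\<Sum>u | interlaces q u \<and> psize u = psize q + k. schur [] u) =
     (if (\<lambda>_. 0) \<in> {u. interlaces q u \<and> psize u = psize q + k} then 1 else (0::'a))"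
    unfolding schur.simps
    by (subst sum.delta[OF finite_interlacing_upper[OF Nil]]) simp
  also have "\<dots> = hsym [] k * schur [] q"
    by (auto simp: 1 psize_0)
  finally show ?case .
next
  case (Cons x xs)
  have fin_up: "finite {i. u i \<noteq> 0}" if "interlaces q u" for u
    using that Cons.prems interlaces_finite_upper by blast
  have fin_dn: "finite {i. u i \<noteq> 0}" if "interlaces u q" for u
    using that Cons.prems interlaces_finite_lower by blast
  let ?A = "SIGMA u:{u. interlaces q u \<and> psize u = psize q + k}. {p. interlaces p u}"
  let ?B = "SIGMA t:{..k}. SIGMA l:{l. interlaces l q}. {p. interlaces l p \<and> psize p = psize l + (k - t)}"
  have "(\<Sum>u | interlaces q u \<and> psize u = psize q + k. schur (x # xs) u) =
      (\<Sum>(u, p)\<in>?A. x ^ (psize u - psize p) * schur xs p)"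
    unfolding schur.simps using Cons.prems fin_up
    by (intro sum.Sigma) (auto intro: finite_interlacing_upper finite_interlacing_lower)
  also have "\<dots> = (\<Sum>(t, l, p)\<in>?B. x ^ t * (x ^ (psize q - psize l) * schur xs p))"
  proof (rule sum.reindex_bij_witness[where
        i = "\<lambda>(t, l, p). (toggle_up p q t l, p)" and
        j = "\<lambda>(u, p). (u 0 - max (p 0) (q 0), toggle_down p q u, p)"])
    fix a assume a: "a \<in> ?A"
    obtain u p where [simp]: "a = (u, p)" by (cases a)
    have i: "interlaces q u" "interlaces p u" and s: "psize u = psize q + k" using a by auto
    define t l where "t = u 0 - max (p 0) (q 0)" and "l = toggle_down p q u"
    have l: "interlaces l p" "interlaces l q"
      unfolding l_def using i toggle_down_interlaces by blast+
    have u: "toggle_up p q t l = u"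
      unfolding l_def by (rule toggle_up_down[OF i(2,1) t_def])
    have sz: "psize u + psize l = psize p + psize q + t"
      using psize_toggle_up[OF l fin_dn[OF l(2)], of t] u by simp
    have le: "psize p \<le> psize u" "psize l \<le> psize q" "psize l \<le> psize p"
      using i l fin_up Cons.prems interlaces_psize_le interlaces_finite_lower by blast+
    show "(\<lambda>(t, l, p). (toggle_up p q t l, p)) ((\<lambda>(u, p). (u 0 - max (p 0) (q 0), toggle_down p q u, p)) a) = a"
      using u by (simp add: t_def l_def)
    show "(\<lambda>(u, p). (u 0 - max (p 0) (q 0), toggle_down p q u, p)) a \<in> ?B"
      using l sz s le by (simp add: t_def[symmetric] l_def[symmetric])
    have "psize u - psize p = t + (psize q - psize l)" using sz le by simp
    then show "(case (\<lambda>(u, p). (u 0 - max (p 0) (q 0), toggle_down p q u, p)) a of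
        (t, l, p) \<Rightarrow> x ^ t * (x ^ (psize q - psize l) * schur xs p)) =
        (case a of (u, p) \<Rightarrow> x ^ (psize u - psize p) * schur xs p)"
      by (simp add: t_def[symmetric] l_def[symmetric] power_add mult.assoc)
  next
    fix b assume b: "b \<in> ?B"
    obtain t l p where [simp]: "b = (t, l, p)" by (cases b) auto
    have i: "interlaces l q" "interlaces l p" and s: "psize p = psize l + (k - t)" and t: "t \<le> k"
      using b by auto
    have u: "interlaces p (toggle_up p q t l)" "interlaces q (toggle_up p q t l)"
      using i toggle_up_interlaces by blast+
    have sz: "psize (toggle_up p q t l) + psize l = psize p + psize q + t"
      by (intro psize_toggle_up i fin_dn)
    show "(\<lambda>(t, l, p). (toggle_up p q t l, p)) b \<in> ?A"
      using u sz s t by simp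
    show "(\<lambda>(u, p). (u 0 - max (p 0) (q 0), toggle_down p q u, p)) ((\<lambda>(t, l, p). (toggle_up p q t l, p)) b) = b"
      using i by (simp add: toggle_down_up) (simp add: toggle_up_def)
  qed
  also have "\<dots> = (\<Sum>t\<le>k. \<Sum>(l, p)\<in>(SIGMA l:{l. interlaces l q}. {p. interlaces l p \<and> psize p = psize l + (k - t)}).
       x ^ t * (x ^ (psize q - psize l) * schur xs p))"
    using Cons.prems fin_dn
    by (subst sum.Sigma) (auto intro!: finite_SigmaI finite_interlacing_upper finite_interlacing_lower
        simp: case_prod_unfold simp del: neq0_conv)
  also have "\<dots> = (\<Sum>t\<le>k. \<Sum>l | interlaces l q. \<Sum>p | interlaces l p \<and> psize p = psize l + (k - t).
       x ^ t * (x ^ (psize q - psize l) * schur xs p))"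
    using Cons.prems fin_dn
    by (subst sum.Sigma) (auto intro!: finite_interlacing_upper finite_interlacing_lower simp del: neq0_conv)
  also have "\<dots> = (\<Sum>t\<le>k. \<Sum>l | interlaces l q. x ^ t * (x ^ (psize q - psize l) * (hsym xs (k - t) * schur xs l)))"
    by (intro sum.cong refl, subst Cons.IH[symmetric]) (auto simp: sum_distrib_left fin_dn simp del: neq0_conv)
  also have "\<dots> = hsym (x # xs) k * schur (x # xs) q"
    by (simp add: sum_product mult_ac)
  finally show ?case .
qed

section \<open>Cauchy's identity, graded by the size of the partition\<close>

definition parts :: "nat \<Rightarrow> (nat \<Rightarrow> nat) set" where
  "parts N = {p. antimono p \<and> finite {i. p i \<noteq> 0} \<and> psize p = N}"

lemma interlaces_antimono:
  assumes "interlaces p q"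
  shows "antimono p" "antimono q"
proof -
  have "p (Suc i) \<le> p i" for i
    using interlacesD[OF assms, of i] interlacesD[OF assms, of "Suc i"] by linarith
  then show "antimono p" by (rule decseq_SucI)
  have "q (Suc i) \<le> q i" for i
    using interlacesD[OF assms, of i] by linarith
  then show "antimono q" by (rule decseq_SucI)
qed

text \<open>A nonzero part at index \<open>i\<close> forces \<open>i + 1\<close> parts to be at
  least 1, so it can occur only for \<open>i < N\<close>.\<close>

lemma finite_parts: "finite (parts N)"
proof -
  have "p i = 0" if p: "p \<in> parts N" and i: "N \<le> i" for p i
  proof (rule ccontr)
    assume nz: "p i \<noteq> 0"
    have "1 \<le> p j" if "j \<le> i" for j
      using p nz antimonoD[of p j i] that by (simp add: parts_def)
    then have "(\<Sum>j\<le>i. 1) \<le> (\<Sum>j\<le>i. p j)" by (intro sum_mono) simp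
    also have "\<dots> = (\<Sum>j\<in>{..i} \<inter> {j. p j \<noteq> 0}. p j)"
      by (intro sum.mono_neutral_right) auto
    also have "\<dots> \<le> psize p"
      unfolding psize_def using p by (intro sum_mono2) (auto simp: parts_def)
    finally show False using p i by (simp add: parts_def)
  qed
  moreover have "p i \<le> N" if "p \<in> parts N" for p i
    using that le_psize[of p i] by (auto simp: parts_def)
  ultimately have "parts N \<subseteq> {p. \<forall>i. p i \<le> N \<and> (N \<le> i \<longrightarrow> p i = 0)}" by blast
  then show ?thesis by (rule finite_subset) (rule finite_bounded_functions)
qed

text \<open>Only the partitions of one size enter, so the infinite sum in Cauchy's identity becomes
  a power series in an auxiliary variable that marks the size.\<close>

definition cauchy_sum :: "'a::comm_ring_1 list \<Rightarrow> 'a list \<Rightarrow> nat \<Rightarrow> 'a" where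
  "cauchy_sum xs ys N = (\<Sum>p\<in>parts N. schur xs p * schur ys p)"

lemma schur_0: "schur xs (\<lambda>_. 0) = 1"
proof (induction xs)
  case (Cons x xs)
  have "{p. interlaces p (\<lambda>_. 0)} = {\<lambda>_. 0}" by (auto simp: interlaces_def)
  then show ?case using Cons by simp
qed simp

lemma cauchy_sum_Nil: "cauchy_sum xs [] N = (if N = 0 then 1 else 0)"
proof -
  have "(\<lambda>_. 0) \<in> parts N \<longleftrightarrow> N = 0"
    by (auto simp: parts_def psize_0 intro: antimonoI)
  then show ?thesis
    using finite_parts[of N] by (simp add: cauchy_sum_def schur_0 if_distrib cong: if_cong)
qed

text \<open>Branching in \<open>y\<close> replaces \<open>q\<close> by a smaller \<open>p\<close>.
  After exchanging the sums, those \<open>q\<close> that exceed \<open>p\<close> by a strip of size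
  \<open>k\<close> are summed by Pieri's rule.\<close>

lemma cauchy_sum_Cons:
  "cauchy_sum xs (y # ys) N = (\<Sum>k\<le>N. y ^ k * hsym xs k * cauchy_sum xs ys (N - k))"
proof -
  let ?A = "SIGMA q:parts N. {p. interlaces p q}"
  let ?B = "SIGMA k:{..N}. SIGMA p:parts (N - k). {q. interlaces p q \<and> psize q = psize p + k}"
  have "cauchy_sum xs (y # ys) N = (\<Sum>q\<in>parts N. \<Sum>p | interlaces p q.
      schur xs q * (y ^ (psize q - psize p) * schur ys p))"
    by (simp add: cauchy_sum_def sum_distrib_left)
  also have "\<dots> = (\<Sum>(q, p)\<in>?A. schur xs q * (y ^ (psize q - psize p) * schur ys p))"
    by (intro sum.Sigma finite_parts) (auto simp: parts_def intro: finite_interlacing_lower)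
  also have "\<dots> = (\<Sum>(k, p, q)\<in>?B. y ^ k * schur ys p * schur xs q)"
  proof (rule sum.reindex_bij_witness[where i = "\<lambda>(k, p, q). (q, p)" and
        j = "\<lambda>(q, p). (psize q - psize p, p, q)"])
    fix a assume a: "a \<in> ?A"
    obtain q p where [simp]: "a = (q, p)" by (cases a)
    have i: "interlaces p q" and q: "finite {i. q i \<noteq> 0}" "psize q = N"
      using a by (auto simp: parts_def)
    have "psize p \<le> psize q" using i q(1) by (rule interlaces_psize_le)
    moreover have "finite {i. p i \<noteq> 0}" using i q(1) by (rule interlaces_finite_lower)
    ultimately show "(\<lambda>(q, p). (psize q - psize p, p, q)) a \<in> ?B"
      using i q interlaces_antimono[OF i] by (simp add: parts_def)
  next
    fix b assume b: "b \<in> ?B"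
    obtain k p q where [simp]: "b = (k, p, q)" by (cases b) auto
    have i: "interlaces p q" and p: "finite {i. p i \<noteq> 0}" "psize p = N - k"
        "psize q = psize p + k" "k \<le> N"
      using b by (auto simp: parts_def)
    then show "(\<lambda>(k, p, q). (q, p)) b \<in> ?A"
      using interlaces_antimono[OF i] interlaces_finite_upper[OF i] by (simp add: parts_def)
  qed (auto simp: mult_ac)
  also have "\<dots> = (\<Sum>k\<le>N. \<Sum>(p, q)\<in>(SIGMA p:parts (N - k). {q. interlaces p q \<and> psize q = psize p + k}).
      y ^ k * schur ys p * schur xs q)"
    by (subst sum.Sigma) (auto simp: case_prod_unfold parts_def
        intro!: finite_SigmaI finite_parts[unfolded parts_def] finite_interlacing_upper simp del: neq0_conv)
  also have "\<dots> = (\<Sum>k\<le>N. \<Sum>p\<in>parts (N - k). \<Sum>q | interlaces p q \<and> psize q = psize p + k.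
      y ^ k * schur ys p * schur xs q)"
    by (intro sum.cong refl sum.Sigma[symmetric] finite_parts ballI finite_interlacing_upper)
       (auto simp: parts_def)
  also have "\<dots> = (\<Sum>k\<le>N. \<Sum>p\<in>parts (N - k). y ^ k * schur ys p * (hsym xs k * schur xs p))"
  proof (intro sum.cong refl)
    fix k p assume "p \<in> parts (N - k)"
    then have "finite {i. p i \<noteq> 0}" by (simp add: parts_def)
    then show "(\<Sum>q | interlaces p q \<and> psize q = psize p + k. y ^ k * schur ys p * schur xs q) =
        y ^ k * schur ys p * (hsym xs k * schur xs p)"
      by (simp only: sum_distrib_left[symmetric] pieri)
  qed
  also have "\<dots> = (\<Sum>k\<le>N. y ^ k * hsym xs k * cauchy_sum xs ys (N - k))"
    by (simp add: cauchy_sum_def sum_distrib_left mult_ac)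
  finally show ?thesis .
qed

lemma hsym_Cons_Suc: "hsym (x # xs) (Suc k) = hsym xs (Suc k) + x * hsym (x # xs) k"
  unfolding hsym.simps by (subst sum.atMost_Suc_shift) (simp add: sum_distrib_left mult.assoc)

lemma one_minus_const_X_mult_nth:
  fixes f :: "'a::comm_ring_1 fps"
  shows "((1 - fps_const c * fps_X) * f) $ n = f $ n - (if n = 0 then 0 else c * f $ (n - 1))"
  by (simp add: left_diff_distrib mult.assoc)

text \<open>The linear factor cancels the geometric series that the variable \<open>x\<close>
  contributes; on coefficients this is \<open>hsym_Cons_Suc\<close>.\<close>

lemma hsym_fps_Cons:
  "(1 - fps_const (x * y) * fps_X) * Abs_fps (\<lambda>k. y ^ k * hsym (x # xs) k) =
   Abs_fps (\<lambda>k. y ^ k * hsym xs k)"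
proof (rule fps_ext)
  fix n
  show "((1 - fps_const (x * y) * fps_X) * Abs_fps (\<lambda>k. y ^ k * hsym (x # xs) k)) $ n =
      Abs_fps (\<lambda>k. y ^ k * hsym xs k) $ n"
    unfolding one_minus_const_X_mult_nth
    by (cases n) (simp_all add: hsym_Cons_Suc algebra_simps del: hsym.simps, simp)
qed

lemma hsym_fps:
  "(\<Prod>x\<leftarrow>xs. 1 - fps_const (x * y) * fps_X) * Abs_fps (\<lambda>k. y ^ k * hsym xs k) = 1"
proof (induction xs)
  case Nil
  show ?case by (rule fps_ext) simp
next
  case (Cons x xs)
  have "(\<Prod>x\<leftarrow>x # xs. 1 - fps_const (x * y) * fps_X) * Abs_fps (\<lambda>k. y ^ k * hsym (x # xs) k) =
      (\<Prod>x\<leftarrow>xs. 1 - fps_const (x * y) * fps_X) *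
      ((1 - fps_const (x * y) * fps_X) * Abs_fps (\<lambda>k. y ^ k * hsym (x # xs) k))"
    by (simp only: list.map prod_list.Cons mult_ac)
  then show ?case by (simp only: hsym_fps_Cons Cons)
qed

text \<open>Each \<open>y\<close> splits off the generating function of \<open>hsym xs\<close>,
  which \<open>hsym_fps\<close> inverts. The form without division is valid over every commutative
  ring, so the variables can later be power series themselves.\<close>

lemma cauchy_identity:
  "(\<Prod>y\<leftarrow>ys. \<Prod>x\<leftarrow>xs. 1 - fps_const (x * y) * fps_X) * Abs_fps (cauchy_sum xs ys) = 1"
proof (induction ys)
  case Nil
  show ?case by (rule fps_ext) (simp add: cauchy_sum_Nil)
next
  case (Cons y ys)
  have "Abs_fps (cauchy_sum xs (y # ys)) =
      Abs_fps (\<lambda>k. y ^ k * hsym xs k) * Abs_fps (cauchy_sum xs ys)"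
    by (rule fps_ext) (simp add: cauchy_sum_Cons fps_mult_nth atLeast0AtMost)
  then have "(\<Prod>y\<leftarrow>y # ys. \<Prod>x\<leftarrow>xs. 1 - fps_const (x * y) * fps_X) * Abs_fps (cauchy_sum xs (y # ys)) =
      ((\<Prod>x\<leftarrow>xs. 1 - fps_const (x * y) * fps_X) * Abs_fps (\<lambda>k. y ^ k * hsym xs k)) *
      ((\<Prod>y\<leftarrow>ys. \<Prod>x\<leftarrow>xs. 1 - fps_const (x * y) * fps_X) * Abs_fps (cauchy_sum xs ys))"
    by (simp only: list.map prod_list.Cons mult_ac)
  then show ?case by (simp only: Cons hsym_fps mult_1)
qed

text \<open>Setting the outer variable to 1 makes sense for a series \<open>G\<close> whose \<open>N\<close>-th coefficient
  is divisible by the \<open>N\<close>-th power of the inner variable.\<close>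

definition eval_at_one :: "'a::comm_ring_1 fps fps \<Rightarrow> 'a fps" where
  "eval_at_one G = Abs_fps (\<lambda>n. \<Sum>N\<le>n. G $ N $ n)"

definition tame :: "'a::comm_ring_1 fps fps \<Rightarrow> bool" where
  "tame G \<longleftrightarrow> (\<forall>N n. n < N \<longrightarrow> G $ N $ n = 0)"

text \<open>As \<open>u\<close> has no constant term, multiplying by \<open>u\<close> raises the
  inner order by one. This makes up for the shift of \<open>N\<close> caused by the outer variable,
  so tameness survives and the evaluation is multiplicative.\<close>

lemma eval_at_one_mult_linear:
  assumes G: "tame G" and u: "u $ 0 = 0"
  shows "tame ((1 - fps_const u * fps_X) * G)"
    "eval_at_one ((1 - fps_const u * fps_X) * G) = (1 - u) * eval_at_one G"
proof -
  have uG: "(u * G $ N) $ n = 0" if "n < Suc N" for N n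
    unfolding fps_mult_nth
  proof (intro sum.neutral ballI)
    fix i assume "i \<in> {0..n}"
    then show "u $ i * G $ N $ (n - i) = 0"
      using that G u by (cases i) (auto simp: tame_def)
  qed
  show "tame ((1 - fps_const u * fps_X) * G)"
    unfolding tame_def one_minus_const_X_mult_nth
  proof (intro allI impI)
    fix N n :: nat assume "n < N"
    then show "(G $ N - (if N = 0 then 0 else u * G $ (N - 1))) $ n = 0"
      using G uG[of n "N - 1"] by (cases N) (auto simp: tame_def)
  qed
  show "eval_at_one ((1 - fps_const u * fps_X) * G) = (1 - u) * eval_at_one G"
  proof (rule fps_ext)
    fix n
    \<comment> \<open>For \<open>i > 0\<close> tameness kills the terms with
      \<open>N > n - i\<close>; for \<open>i = 0\<close> both sides vanish with
      \<open>u $ 0\<close>.\<close>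
    have eq: "u $ i * (\<Sum>N<n. G $ N $ (n - i)) = u $ i * (\<Sum>N\<le>n - i. G $ N $ (n - i))"
      if "i \<le> n" for i
    proof (cases "i = 0")
      case False
      then have "(\<Sum>N<n. G $ N $ (n - i)) = (\<Sum>N\<le>n - i. G $ N $ (n - i))"
        using that G by (intro sum.mono_neutral_right) (auto simp: tame_def)
      then show ?thesis by simp
    qed (simp add: u)
    have "(\<Sum>N\<le>n. (if N = 0 then 0 else u * G $ (N - 1)) $ n) = (\<Sum>N<n. (u * G $ N) $ n)"
      by (subst sum.atMost_shift) simp
    also have "\<dots> = (\<Sum>i=0..n. u $ i * (\<Sum>N<n. G $ N $ (n - i)))"
      unfolding fps_mult_nth by (subst sum.swap) (simp add: sum_distrib_left)
    also have "\<dots> = (u * eval_at_one G) $ n"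
      unfolding fps_mult_nth by (intro sum.cong) (auto simp: eval_at_one_def eq)
    finally have "(\<Sum>N\<le>n. (if N = 0 then 0 else u * G $ (N - 1)) $ n) = (u * eval_at_one G) $ n" .
    moreover have "eval_at_one ((1 - fps_const u * fps_X) * G) $ n =
        (\<Sum>N\<le>n. G $ N $ n) - (\<Sum>N\<le>n. (if N = 0 then 0 else u * G $ (N - 1)) $ n)"
      unfolding eval_at_one_def one_minus_const_X_mult_nth fps_nth_Abs_fps fps_sub_nth sum_subtractf ..
    ultimately show "eval_at_one ((1 - fps_const u * fps_X) * G) $ n = ((1 - u) * eval_at_one G) $ n"
      by (simp add: left_diff_distrib) (simp add: eval_at_one_def)
  qed
qed

lemma eval_at_one_prod:
  assumes "tame G" "\<And>u. u \<in> set us \<Longrightarrow> u $ 0 = 0"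
  shows "tame ((\<Prod>u\<leftarrow>us. 1 - fps_const u * fps_X) * G) \<and>
    eval_at_one ((\<Prod>u\<leftarrow>us. 1 - fps_const u * fps_X) * G) = (\<Prod>u\<leftarrow>us. 1 - u) * eval_at_one G"
  using assms(2)
proof (induction us)
  case (Cons u us)
  then show ?case
    using eval_at_one_mult_linear[of "(\<Prod>u\<leftarrow>us. 1 - fps_const u * fps_X) * G" u]
    by (simp add: mult.assoc)
qed (simp add: assms)

lemma eval_at_one_1: "eval_at_one 1 = 1"
proof (rule fps_ext)
  fix n
  have "eval_at_one 1 $ n = (\<Sum>N\<le>n. if N = 0 then 1 $ n else 0)"
    unfolding eval_at_one_def fps_nth_Abs_fps by (intro sum.cong) auto
  then show "eval_at_one (1 :: 'a fps fps) $ n = 1 $ n" by simp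
qed

text \<open>Flattens the double product into the single list that \<open>eval_at_one_prod\<close>
  expects.\<close>

lemma prod_list_concat_map:
  "(\<Prod>y\<leftarrow>ys. \<Prod>x\<leftarrow>xs. f (x * y)) =
   (\<Prod>u\<leftarrow>concat (map (\<lambda>y. map (\<lambda>x. x * y) xs) ys). f u)"
  by (induction ys) (simp_all add: o_def)

lemma eval_at_one_cauchy_sum:
  fixes xs ys :: "'a::comm_ring_1 fps list"
  assumes "tame (Abs_fps (cauchy_sum xs ys))" "\<And>x. x \<in> set xs \<Longrightarrow> x $ 0 = 0"
  shows "(\<Prod>y\<leftarrow>ys. \<Prod>x\<leftarrow>xs. 1 - x * y) * eval_at_one (Abs_fps (cauchy_sum xs ys)) = 1"
proof -
  define us where "us = concat (map (\<lambda>y. map (\<lambda>x. x * y) xs) ys)"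
  have "u $ 0 = 0" if "u \<in> set us" for u
    using that assms(2) by (auto simp: us_def)
  then have "eval_at_one ((\<Prod>u\<leftarrow>us. 1 - fps_const u * fps_X) * Abs_fps (cauchy_sum xs ys)) =
      (\<Prod>u\<leftarrow>us. 1 - u) * eval_at_one (Abs_fps (cauchy_sum xs ys))"
    using eval_at_one_prod assms(1) by blast
  then show ?thesis
    using cauchy_identity[of xs ys]
    unfolding us_def prod_list_concat_map[where f = "\<lambda>u. 1 - fps_const u * fps_X", symmetric]
      prod_list_concat_map[where f = "\<lambda>u. 1 - u", symmetric]
    by (simp only: eval_at_one_1)
qed

section \<open>Plane partitions as chains of diagonals\<close>

text \<open>\<open>D k\<close> is the diagonal at distance \<open>k\<close> from the main diagonal
  \<open>p\<close>, on one side of it.\<close>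

definition diagonal_chains :: "nat \<Rightarrow> (nat \<Rightarrow> nat) \<Rightarrow> (nat \<Rightarrow> nat \<Rightarrow> nat) set" where
  "diagonal_chains m p = {D. D 0 = p \<and> (\<forall>k. interlaces (D (Suc k)) (D k)) \<and> (\<forall>k\<ge>m. D k = (\<lambda>_. 0))}"

text \<open>\<open>D 0\<close> is left out: the main diagonal is shared by two chains and has to be
  counted once.\<close>

definition tail_size :: "nat \<Rightarrow> (nat \<Rightarrow> nat \<Rightarrow> nat) \<Rightarrow> nat" where
  "tail_size m D = (\<Sum>k<m. psize (D (Suc k)))"

lemma diagonal_chains_0: "diagonal_chains 0 p = (if p = (\<lambda>_. 0) then {\<lambda>_ _. 0} else {})"
proof -
  have "D \<in> diagonal_chains 0 p \<longleftrightarrow> p = (\<lambda>_. 0) \<and> D = (\<lambda>_ _. 0)" for D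
    by (auto simp: diagonal_chains_def interlaces_def fun_eq_iff)
  then show ?thesis by auto
qed

lemma bij_betw_diagonal_chains_Suc:
  "bij_betw (\<lambda>(q, D). case_nat p D) (SIGMA q:{q. interlaces q p}. diagonal_chains m q) (diagonal_chains (Suc m) p)"
proof (rule bij_betwI[where g = "\<lambda>D. (D 1, \<lambda>k. D (Suc k))"])
  show "(\<lambda>(q, D). case_nat p D) \<in> (SIGMA q:{q. interlaces q p}. diagonal_chains m q) \<rightarrow> diagonal_chains (Suc m) p"
    by (auto simp: diagonal_chains_def split: nat.splits)
  show "(\<lambda>D. (D 1, \<lambda>k. D (Suc k))) \<in> diagonal_chains (Suc m) p \<rightarrow> (SIGMA q:{q. interlaces q p}. diagonal_chains m q)"
    by (auto simp: diagonal_chains_def)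
  show "(\<lambda>D. (D 1, \<lambda>k. D (Suc k))) ((\<lambda>(q, D). case_nat p D) a) = a"
    if "a \<in> (SIGMA q:{q. interlaces q p}. diagonal_chains m q)" for a
    using that by (auto simp: diagonal_chains_def)
  show "(\<lambda>(q, D). case_nat p D) (D 1, \<lambda>k. D (Suc k)) = D" if "D \<in> diagonal_chains (Suc m) p" for D
    using that by (auto simp: diagonal_chains_def fun_eq_iff split: nat.splits)
qed

lemma finite_diagonal_chains:
  assumes "finite {i. p i \<noteq> 0}"
  shows "finite (diagonal_chains m p)"
  using assms
proof (induction m arbitrary: p)
  case 0
  show ?case by (simp add: diagonal_chains_0)
next
  case (Suc m)
  have "finite (SIGMA q:{q. interlaces q p}. diagonal_chains m q)"
    using Suc interlaces_finite_lower by (blast intro: finite_SigmaI finite_interlacing_lower)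
  then show ?case using bij_betw_finite bij_betw_diagonal_chains_Suc by blast
qed

text \<open>Summation by parts: the strip between \<open>D i\<close> and \<open>D (Suc i)\<close>
  has weight \<open>j + i\<close> per cell, so \<open>D 0\<close> counts \<open>j\<close> times and
  every later diagonal once. The offset \<open>j\<close> is general because dropping the first
  variable raises it by one.\<close>

lemma schur_powers_of_X:
  assumes "finite {i. p i \<noteq> 0}"
  shows "schur (map (\<lambda>i. fps_X ^ (j + i)) [0..<m]) p =
    (fps_X :: 'a::comm_ring_1 fps) ^ (j * psize p) * (\<Sum>D\<in>diagonal_chains m p. fps_X ^ tail_size m D)"
  using assms
proof (induction m arbitrary: j p)
  case 0
  show ?case by (simp add: diagonal_chains_0 psize_0 tail_size_def)
next
  case (Suc m)
  have fin: "finite {i. q i \<noteq> 0}" "psize q \<le> psize p" if "interlaces q p" for q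
    using that Suc.prems interlaces_finite_lower interlaces_psize_le by blast+
  have ts: "tail_size (Suc m) (case_nat p D) = psize q + tail_size m D" if "D \<in> diagonal_chains m q" for q D
    using that unfolding tail_size_def by (subst sum.lessThan_Suc_shift) (simp add: diagonal_chains_def)
  have "schur (map (\<lambda>i. fps_X ^ (j + i)) [0..<Suc m]) p =
      (\<Sum>q | interlaces q p. (fps_X ^ j) ^ (psize p - psize q) *
        schur (map (\<lambda>i. (fps_X :: 'a fps) ^ (Suc j + i)) [0..<m]) q)"
    by (simp add: map_upt_Suc del: upt_Suc)
  also have "\<dots> = (\<Sum>q | interlaces q p. (fps_X ^ j) ^ (psize p - psize q) *
        (fps_X ^ (Suc j * psize q) * (\<Sum>D\<in>diagonal_chains m q. fps_X ^ tail_size m D)))"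
    by (intro sum.cong refl arg_cong2[where f = "(*)"] Suc.IH fin) auto
  also have "\<dots> = (\<Sum>q | interlaces q p. \<Sum>D\<in>diagonal_chains m q.
       fps_X ^ (j * psize p) * fps_X ^ (psize q + tail_size m D))"
  proof (intro sum.cong refl)
    fix q assume "q \<in> {q. interlaces q p}"
    then have "j * (psize p - psize q) + (Suc j * psize q) = j * psize p + psize q"
      using fin(2)[of q] by (simp add: diff_mult_distrib2)
    then have "(fps_X ^ j) ^ (psize p - psize q) * fps_X ^ (Suc j * psize q) =
        (fps_X :: 'a fps) ^ (j * psize p) * fps_X ^ psize q"
      by (metis power_mult power_add)
    then show "(fps_X ^ j) ^ (psize p - psize q) *
        (fps_X ^ (Suc j * psize q) * (\<Sum>D\<in>diagonal_chains m q. fps_X ^ tail_size m D)) =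
        (\<Sum>D\<in>diagonal_chains m q. (fps_X :: 'a fps) ^ (j * psize p) * fps_X ^ (psize q + tail_size m D))"
      by (simp only: mult.assoc[symmetric] sum_distrib_left power_add)
  qed
  also have "\<dots> = (\<Sum>(q, D)\<in>(SIGMA q:{q. interlaces q p}. diagonal_chains m q).
       fps_X ^ (j * psize p) * fps_X ^ (psize q + tail_size m D))"
    using Suc.prems fin by (intro sum.Sigma finite_interlacing_lower ballI finite_diagonal_chains) auto
  also have "\<dots> = (\<Sum>D\<in>diagonal_chains (Suc m) p. fps_X ^ (j * psize p) * fps_X ^ tail_size (Suc m) D)"
    unfolding sum.reindex_bij_betw[OF bij_betw_diagonal_chains_Suc, symmetric]
    by (intro sum.cong refl) (auto simp: ts)
  finally show ?case by (simp add: sum_distrib_left)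
qed

definition chain_pairs :: "nat \<Rightarrow> nat \<Rightarrow> nat \<Rightarrow> (nat \<times> (nat \<Rightarrow> nat) \<times> (nat \<Rightarrow> nat \<Rightarrow> nat) \<times> (nat \<Rightarrow> nat \<Rightarrow> nat)) set" where
  "chain_pairs r m n = {(N, p, E, D). p \<in> parts N \<and> E \<in> diagonal_chains r p \<and> D \<in> diagonal_chains m p \<and>
     N + tail_size r E + tail_size m D = n}"

definition arrays :: "nat \<Rightarrow> nat \<Rightarrow> (nat \<Rightarrow> nat \<Rightarrow> nat) set" where
  "arrays r m = {a. (\<forall>i j. a (Suc i) j \<le> a i j \<and> a i (Suc j) \<le> a i j) \<and>
     (\<forall>i j. r \<le> i \<or> m \<le> j \<longrightarrow> a i j = 0)}"

definition array_sum :: "nat \<Rightarrow> nat \<Rightarrow> (nat \<Rightarrow> nat \<Rightarrow> nat) \<Rightarrow> nat" where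
  "array_sum r m a = (\<Sum>i<r. \<Sum>j<m. a i j)"

text \<open>The exponents start at 1 on one side and at 0 on the other, so that the common main
  diagonal is counted exactly once.\<close>

lemma cauchy_sum_powers_of_X:
  "cauchy_sum (map (\<lambda>i. fps_X ^ (1 + i)) [0..<r]) (map (\<lambda>i. fps_X ^ (0 + i)) [0..<m]) N =
   (\<Sum>p\<in>parts N. \<Sum>E\<in>diagonal_chains r p. \<Sum>D\<in>diagonal_chains m p.
     (fps_X :: 'a::comm_ring_1 fps) ^ (N + tail_size r E + tail_size m D))"
  unfolding cauchy_sum_def
proof (intro sum.cong refl)
  fix p assume "p \<in> parts N"
  then have p: "finite {i. p i \<noteq> 0}" "psize p = N" by (auto simp: parts_def)
  show "schur (map (\<lambda>i. fps_X ^ (1 + i)) [0..<r]) p * schur (map (\<lambda>i. fps_X ^ (0 + i)) [0..<m]) p =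
      (\<Sum>E\<in>diagonal_chains r p. \<Sum>D\<in>diagonal_chains m p. (fps_X :: 'a fps) ^ (N + tail_size r E + tail_size m D))"
    unfolding schur_powers_of_X[OF p(1)] p(2)
    by (simp only: mult_1 mult_0 power_0 mult.assoc sum_product)
      (simp only: power_add sum_distrib_left mult.assoc)
qed

text \<open>All exponents are at least \<open>N\<close>. This gives tameness, and it shows that the
  sizes \<open>N <= n\<close> already account for all of \<open>chain_pairs r m n\<close>.\<close>

lemma eval_cauchy_sum_nth:
  fixes r m :: nat and C :: "nat \<Rightarrow> 'a::comm_ring_1 fps"
  defines "C \<equiv> cauchy_sum (map (\<lambda>i. fps_X ^ (1 + i)) [0..<r]) (map (\<lambda>i. fps_X ^ (0 + i)) [0..<m])"
  shows "tame (Abs_fps C)"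
    and "eval_at_one (Abs_fps C) $ n = of_nat (card (chain_pairs r m n))"
proof -
  have nth: "C N $ n = (\<Sum>p\<in>parts N. \<Sum>E\<in>diagonal_chains r p. \<Sum>D\<in>diagonal_chains m p.
      if N + tail_size r E + tail_size m D = n then 1 else (0 :: 'a))" for N n
    unfolding C_def cauchy_sum_powers_of_X by (simp add: fps_sum_nth fps_X_power_nth eq_commute)
  show "tame (Abs_fps C)"
    unfolding tame_def fps_nth_Abs_fps nth by (auto intro!: sum.neutral)
  have fin: "finite (diagonal_chains k p)" if "p \<in> parts N" for k N p
    using that by (intro finite_diagonal_chains) (simp add: parts_def)
  let ?S = "SIGMA N:{..n}. SIGMA p:parts N. diagonal_chains r p \<times> diagonal_chains m p"
  have finS: "finite ?S"
    using fin by (intro finite_SigmaI finite_parts finite_cartesian_product) auto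
  have "eval_at_one (Abs_fps C) $ n = (\<Sum>N\<le>n. \<Sum>p\<in>parts N. \<Sum>(E, D)\<in>diagonal_chains r p \<times> diagonal_chains m p.
      if N + tail_size r E + tail_size m D = n then 1 else (0 :: 'a))"
    by (simp add: eval_at_one_def nth sum.cartesian_product)
  also have "\<dots> = (\<Sum>N\<le>n. \<Sum>(p, E, D)\<in>(SIGMA p:parts N. diagonal_chains r p \<times> diagonal_chains m p).
      if N + tail_size r E + tail_size m D = n then 1 else (0 :: 'a))"
    using fin by (intro sum.cong refl sum.Sigma finite_parts) auto
  also have "\<dots> = (\<Sum>(N, p, E, D)\<in>?S. if N + tail_size r E + tail_size m D = n then 1 else (0 :: 'a))"
    using fin by (intro sum.Sigma finite_atMost ballI finite_SigmaI finite_parts finite_cartesian_product) auto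
  also have "\<dots> = (\<Sum>s\<in>?S. if (case s of (N, p, E, D) \<Rightarrow> N + tail_size r E + tail_size m D = n) then 1 else 0)"
    by (intro sum.cong) auto
  also have "\<dots> = of_nat (card {s \<in> ?S. case s of (N, p, E, D) \<Rightarrow> N + tail_size r E + tail_size m D = n})"
    using finS by (simp add: sum.If_cases Int_def)
  also have "{s \<in> ?S. case s of (N, p, E, D) \<Rightarrow> N + tail_size r E + tail_size m D = n} = chain_pairs r m n"
    by (auto simp: chain_pairs_def)
  finally show "eval_at_one (Abs_fps C) $ n = of_nat (card (chain_pairs r m n))" .
qed

lemma arrays_antimono:
  assumes "a \<in> arrays r m"
  shows "i \<le> i' \<Longrightarrow> j \<le> j' \<Longrightarrow> a i' j' \<le> a i j"
proof -
  assume "i \<le> i'" "j \<le> j'"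
  have "a i' j' \<le> a i' j"
    by (rule lift_Suc_antimono_le[where f = "a i'"]) (use assms \<open>j \<le> j'\<close> in \<open>auto simp: arrays_def\<close>)
  also have "\<dots> \<le> a i j"
    by (rule lift_Suc_antimono_le[where f = "\<lambda>i. a i j"]) (use assms \<open>i \<le> i'\<close> in \<open>auto simp: arrays_def\<close>)
  finally show ?thesis .
qed

lemma array_sum_diagonals:
  assumes a: "a \<in> arrays r m"
  shows "array_sum r m a = psize (\<lambda>i. a i i) +
    tail_size r (\<lambda>k i. a (i + k) i) + tail_size m (\<lambda>k i. a i (i + k))"
proof -
  define M where "M = r + m"
  have z: "a i j = 0" if "r \<le> i \<or> m \<le> j" for i j
    using a that by (auto simp: arrays_def)
  have nz: "i < r" "j < m" if "0 < a i j" for i j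
    using z[of i j] that by (auto simp: not_less[symmetric])
  have ps: "psize p = sum p {..<M}" if "\<And>i. M \<le> i \<Longrightarrow> p i = 0" for p
    using that by (intro psize_eq_sum) auto
  \<comment> \<open>A square of side \<open>M = r + m\<close> contains all nonzero entries and is
    large enough for every diagonal on either side.\<close>
  have diag: "psize (\<lambda>i. a i i) = (\<Sum>i<M. a i i)"
    by (rule ps) (simp add: z M_def)
  let ?Q = "{..<M} \<times> {..<M}"
  have "array_sum r m a = (\<Sum>(i, j)\<in>{..<r} \<times> {..<m}. a i j)"
    by (simp add: array_sum_def sum.cartesian_product)
  also have "\<dots> = (\<Sum>(i, j)\<in>?Q. a i j)"
    by (rule sum.mono_neutral_left) (auto simp: M_def dest: nz)
  also have "?Q = {(i, j) \<in> ?Q. i = j} \<union> ({(i, j) \<in> ?Q. j < i} \<union> {(i, j) \<in> ?Q. i < j})"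
    by auto
  also have "(\<Sum>(i, j)\<in>\<dots>. a i j) = (\<Sum>(i, j)\<in>{(i, j) \<in> ?Q. i = j}. a i j) +
      ((\<Sum>(i, j)\<in>{(i, j) \<in> ?Q. j < i}. a i j) + (\<Sum>(i, j)\<in>{(i, j) \<in> ?Q. i < j}. a i j))"
    by (subst sum.union_disjoint; (subst sum.union_disjoint)?)
      (auto intro: finite_subset[of _ "{..<M} \<times> {..<M}"])
  also have "(\<Sum>(i, j)\<in>{(i, j) \<in> ?Q. i = j}. a i j) = psize (\<lambda>i. a i i)"
    unfolding diag
    by (rule sum.reindex_bij_witness[where i = "\<lambda>i. (i, i)" and j = fst]) auto
  \<comment> \<open>\<open>k\<close> is the distance from the main diagonal minus one. The indices
    in \<open>S'\<close> and \<open>T'\<close> carry zero entries and are exempt from the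
    bijection.\<close>
  also have "(\<Sum>(i, j)\<in>{(i, j) \<in> ?Q. j < i}. a i j) = (\<Sum>(k, i)\<in>{..<r} \<times> {..<M}. a (i + Suc k) i)"
    by (rule sum.reindex_bij_witness_not_neutral[where
          i = "\<lambda>(k, i). (i + Suc k, i)" and j = "\<lambda>(i, j). (i - Suc j, j)"
          and S' = "{(i, j) \<in> ?Q. j < i \<and> r \<le> i}"
          and T' = "{(k, i) \<in> {..<r} \<times> {..<M}. r \<le> i + Suc k}"])
      (auto simp: z M_def intro: finite_subset[of _ "{..<M} \<times> {..<M}"])
  also have "\<dots> = tail_size r (\<lambda>k i. a (i + k) i)"
    unfolding tail_size_def sum.cartesian_product[symmetric]
    by (intro sum.cong refl ps[symmetric]) (auto simp: z M_def)
  also have "(\<Sum>(i, j)\<in>{(i, j) \<in> ?Q. i < j}. a i j) = (\<Sum>(k, i)\<in>{..<m} \<times> {..<M}. a i (i + Suc k))"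
    by (rule sum.reindex_bij_witness_not_neutral[where
          i = "\<lambda>(k, i). (i, i + Suc k)" and j = "\<lambda>(i, j). (j - Suc i, i)"
          and S' = "{(i, j) \<in> ?Q. i < j \<and> m \<le> j}"
          and T' = "{(k, i) \<in> {..<m} \<times> {..<M}. m \<le> i + Suc k}"])
      (auto simp: z M_def intro: finite_subset[of _ "{..<M} \<times> {..<M}"])
  also have "\<dots> = tail_size m (\<lambda>k i. a i (i + k))"
    unfolding tail_size_def sum.cartesian_product[symmetric]
    by (intro sum.cong refl ps[symmetric]) (auto simp: z M_def)
  finally show ?thesis by simp
qed

text \<open>Interlacing of neighbouring diagonals is monotonicity along rows and columns, read
  diagonally.\<close>

lemma arrays_diagonals:
  assumes a: "a \<in> arrays r m"
  shows "(\<lambda>k i. a (i + k) i) \<in> diagonal_chains r (\<lambda>i. a i i)" "(\<lambda>k i. a i (i + k)) \<in> diagonal_chains m (\<lambda>i. a i i)"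
    "(\<lambda>i. a i i) \<in> parts (psize (\<lambda>i. a i i))"
proof -
  show "(\<lambda>k i. a (i + k) i) \<in> diagonal_chains r (\<lambda>i. a i i)" "(\<lambda>k i. a i (i + k)) \<in> diagonal_chains m (\<lambda>i. a i i)"
    using a by (auto simp: diagonal_chains_def interlaces_def arrays_def fun_eq_iff)
  have "a i i = 0" if "r \<le> i" for i using a that by (auto simp: arrays_def)
  then have "finite {i. a i i \<noteq> 0}" unfolding finite_support_iff_eventually_0 by blast
  moreover have "antimono (\<lambda>i. a i i)" by (intro antimonoI arrays_antimono[OF a])
  ultimately show "(\<lambda>i. a i i) \<in> parts (psize (\<lambda>i. a i i))" by (simp add: parts_def)
qed

lemma chains_glue_in_arrays:
  assumes E: "E \<in> diagonal_chains r p" and D: "D \<in> diagonal_chains m p"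
  shows "(\<lambda>i j. if i \<le> j then D (j - i) i else E (i - j) j) \<in> arrays r m"
proof -
  have e: "E 0 = p" "\<And>k i. E (Suc k) i \<le> E k i" "\<And>k i. E k (Suc i) \<le> E (Suc k) i"
      "\<And>k i. r \<le> k \<Longrightarrow> E k i = 0"
    using E by (auto simp: diagonal_chains_def interlaces_def)
  have d: "D 0 = p" "\<And>k i. D (Suc k) i \<le> D k i" "\<And>k i. D k (Suc i) \<le> D (Suc k) i"
      "\<And>k i. m \<le> k \<Longrightarrow> D k i = 0"
    using D by (auto simp: diagonal_chains_def interlaces_def)
  \<comment> \<open>Following \<open>F k (Suc i) <= F (Suc k) i\<close> down to position 0 bounds
    \<open>F k i\<close> by \<open>F (k + i) 0\<close>, which lies beyond the end of the chain. This
    confines the glued array to its box.\<close>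
  have shift: "F k i = 0" if "\<And>k i. F k (Suc i) \<le> F (Suc k) i" "\<And>k i. L \<le> k \<Longrightarrow> F k i = 0" "L \<le> k + i"
    for F :: "nat \<Rightarrow> nat \<Rightarrow> nat" and k i L
    using that(3)
  proof (induction i arbitrary: k)
    case (Suc i)
    then show ?case using that(1)[of k i] by (metis add_Suc_shift le_zero_eq)
  qed (use that in simp)
  let ?a = "\<lambda>i j. if i \<le> j then D (j - i) i else E (i - j) j"
  have down: "?a (Suc i) j \<le> ?a i j" for i j
  proof (cases "Suc i \<le> j")
    case True
    then obtain k where "j = Suc i + k" using le_Suc_ex by blast
    then show ?thesis using d(3)[of k i] by simp
  next
    case False
    then obtain k where "i = j + k" using le_Suc_ex[of j i] by auto
    then show ?thesis using e(2)[of k j] by (cases k) (simp_all add: e(1) d(1))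
  qed
  have right: "?a i (Suc j) \<le> ?a i j" for i j
  proof (cases "i \<le> j")
    case True
    then obtain k where "j = i + k" using le_Suc_ex by blast
    then show ?thesis using d(2)[of k i] by simp
  next
    case False
    then obtain k where "i = Suc j + k" using le_Suc_ex[of "Suc j" i] by auto
    then show ?thesis using e(3)[of k j] by (cases k) (simp_all add: e(1) d(1))
  qed
  have "?a i j = 0" if "r \<le> i" for i j
  proof (cases "i \<le> j")
    case True
    then have "D (j - i) i \<le> p i"
      using lift_Suc_antimono_le[of "\<lambda>k. D k i" 0 "j - i"] d(1,2) by simp
    also have "p i = 0" using shift[of E r 0 i, OF e(3,4)] that e(1) by simp
    finally show ?thesis using True by simp
  qed (use shift[of E r "i - j" j, OF e(3,4)] that in simp)
  moreover have "?a i j = 0" if "m \<le> j" for i j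
  proof (cases "i \<le> j")
    case False
    then have "E (i - j) j \<le> p j"
      using lift_Suc_antimono_le[of "\<lambda>k. E k j" 0 "i - j"] e(1,2) by simp
    also have "p j = 0" using shift[of D m 0 j, OF d(3,4)] that d(1) by simp
    finally show ?thesis using False by simp
  qed (use shift[of D m "j - i" i, OF d(3,4)] that in simp)
  ultimately show ?thesis unfolding arrays_def using down right by blast
qed

lemma bij_betw_diagonals:
  "bij_betw (\<lambda>a. (psize (\<lambda>i. a i i), \<lambda>i. a i i, \<lambda>k i. a (i + k) i, \<lambda>k i. a i (i + k)))
    {a \<in> arrays r m. array_sum r m a = n} (chain_pairs r m n)"
proof (rule bij_betwI[where g = "\<lambda>(N, p, E, D) i j. if i \<le> j then D (j - i) i else E (i - j) j"])
  let ?f = "\<lambda>a. (psize (\<lambda>i. a i i), \<lambda>i. a i i, \<lambda>k i. a (i + k) i, \<lambda>k i. a i (i + k))"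
  let ?g = "\<lambda>(N :: nat, p :: nat \<Rightarrow> nat, E, D) i j. if i \<le> j then D (j - i) i else E (i - j) j :: nat"
  show "?f \<in> {a \<in> arrays r m. array_sum r m a = n} \<rightarrow> chain_pairs r m n"
    by (auto simp: chain_pairs_def array_sum_diagonals arrays_diagonals)
  show "?g (?f a) = a" if "a \<in> {a \<in> arrays r m. array_sum r m a = n}" for a
    by (auto simp: fun_eq_iff)
  have inv: "?f (?g c) = c" if "c \<in> chain_pairs r m n" for c
    using that by (auto simp: chain_pairs_def diagonal_chains_def parts_def fun_eq_iff)
  show "?f (?g c) = c" if "c \<in> chain_pairs r m n" for c
    using that by (rule inv)
  show "?g \<in> chain_pairs r m n \<rightarrow> {a \<in> arrays r m. array_sum r m a = n}"
  proof
    fix c assume c: "c \<in> chain_pairs r m n"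
    obtain N p E D where c_eq: "c = (N, p, E, D)" by (cases c) auto
    have arr: "?g c \<in> arrays r m"
      using c chains_glue_in_arrays by (auto simp: c_eq chain_pairs_def)
    have "array_sum r m (?g c) = N + tail_size r E + tail_size m D"
      using array_sum_diagonals[OF arr] inv[OF c] unfolding c_eq by auto
    then show "?g c \<in> {a \<in> arrays r m. array_sum r m a = n}"
      using arr c by (simp add: c_eq chain_pairs_def)
  qed
qed

text \<open>MacMahon's product for \<open>r\<close> rows and \<open>m\<close> columns with unbounded
  entries: Cauchy's identity in the variables \<open>X ^ (1 + i)\<close> and
  \<open>X ^ j\<close>.\<close>

lemma arrays_generating_function:
  "(\<Prod>j<m. \<Prod>i<r. 1 - fps_X ^ (i + j + 1)) *
   Abs_fps (\<lambda>n. of_nat (card {a \<in> arrays r m. array_sum r m a = n})) = (1 :: 'a::comm_ring_1 fps)"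
proof -
  have card: "card {a \<in> arrays r m. array_sum r m a = n} = card (chain_pairs r m n)" for n
    using bij_betw_same_card[OF bij_betw_diagonals] .
  let ?xs = "map (\<lambda>i. fps_X ^ (1 + i)) [0..<r] :: 'a fps list"
  let ?ys = "map (\<lambda>i. fps_X ^ (0 + i)) [0..<m] :: 'a fps list"
  have "(\<Prod>y\<leftarrow>?ys. \<Prod>x\<leftarrow>?xs. 1 - x * y) * eval_at_one (Abs_fps (cauchy_sum ?xs ?ys)) = 1"
    by (rule eval_at_one_cauchy_sum) (use eval_cauchy_sum_nth(1)[of r m] in auto)
  also have "(\<Prod>y\<leftarrow>?ys. \<Prod>x\<leftarrow>?xs. 1 - x * y) = (\<Prod>j<m. \<Prod>i<r. 1 - fps_X ^ (i + j + 1))"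
    by (simp add: o_def prod.distinct_set_conv_list[symmetric] atLeast0LessThan power_add mult_ac)
  also have "eval_at_one (Abs_fps (cauchy_sum ?xs ?ys)) =
      Abs_fps (\<lambda>n. of_nat (card {a \<in> arrays r m. array_sum r m a = n}))"
    by (rule fps_ext) (simp only: eval_cauchy_sum_nth(2) card fps_nth_Abs_fps)
  finally show ?thesis .
qed

section \<open>From zero-padded arrays to lists of rows\<close>

definition array_of :: "nat list list \<Rightarrow> nat \<Rightarrow> nat \<Rightarrow> nat" where
  "array_of P i j = (if i < length P \<and> j < length (P ! i) then P ! i ! j else 0)"

lemma array_of_pos_iff:
  assumes "plane_partition P"
  shows "0 < array_of P i j \<longleftrightarrow> i < length P \<and> j < length (P ! i)"
  using assms by (auto simp: array_of_def plane_partition_def dest: nth_mem)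

lemma plane_partition_row_pos:
  assumes "plane_partition P"
  shows "0 < array_of P i 0 \<longleftrightarrow> i < length P"
  using assms unfolding array_of_pos_iff[OF assms] by (auto simp: plane_partition_def)

text \<open>Entries of a plane partition are positive, so the support of the padded array determines
  the shape.\<close>

lemma inj_on_array_of: "inj_on array_of {P. plane_partition P}"
proof (rule inj_onI)
  fix P Q assume P: "P \<in> {P. plane_partition P}" and Q: "Q \<in> {P. plane_partition P}"
    and eq: "array_of P = array_of Q"
  have "i < length P \<longleftrightarrow> i < length Q" for i
    using plane_partition_row_pos[of P i] plane_partition_row_pos[of Q i] P Q eq by simp
  then have len: "length P = length Q"
    by (metis linorder_neqE_nat less_irrefl)
  show "P = Q"
  proof (rule nth_equalityI[OF len])
    fix i assume i: "i < length P"
    have "j < length (P ! i) \<longleftrightarrow> j < length (Q ! i)" for j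
      using array_of_pos_iff[of P i j] array_of_pos_iff[of Q i j] P Q eq i len by simp
    then have leni: "length (P ! i) = length (Q ! i)"
      by (metis linorder_neqE_nat less_irrefl)
    show "P ! i = Q ! i"
    proof (rule nth_equalityI[OF leni])
      fix j assume j: "j < length (P ! i)"
      have "array_of P i j = array_of Q i j" using eq by simp
      then show "P ! i ! j = Q ! i ! j" using i j len leni by (simp add: array_of_def)
    qed
  qed
qed

text \<open>A row of positive entries is no longer than its sum, so \<open>m >= n\<close> columns
  cut nothing off.\<close>

lemma array_of_in_arrays:
  assumes "P \<in> plane_partitions r n" "n \<le> m"
  shows "array_of P \<in> arrays r m" "array_sum r m (array_of P) = n"
proof -
  have pp: "plane_partition P" and r: "length P \<le> r" and n: "sum_list (map sum_list P) = n"
    using assms(1) by (auto simp: plane_partitions_def)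
  have row_len: "length (P ! i) \<le> m" if i: "i < length P" for i
  proof -
    have "length (P ! i) \<le> sum_list (P ! i)"
      using pp i by (intro length_le_sum_list_pos) (auto simp: plane_partition_def)
    also have "\<dots> \<le> n"
      using i n member_le_sum_list[of "sum_list (P ! i)" "map sum_list P"] by auto
    finally show ?thesis using assms(2) by simp
  qed
  have lens: "length (P ! Suc i) \<le> length (P ! i)" if "Suc i < length P" for i
    using pp that sorted_wrt_nth_less[of "(\<ge>)" "map length P" i "Suc i"]
    by (simp add: plane_partition_def)
  have "array_of P (Suc i) j \<le> array_of P i j" for i j
    using pp lens[of i] by (auto simp: array_of_def plane_partition_def)
  moreover have "array_of P i (Suc j) \<le> array_of P i j" for i j
    using pp sorted_wrt_nth_less[of "(\<ge>)" "P ! i" j "Suc j"]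
    by (auto simp: array_of_def plane_partition_def)
  moreover have "array_of P i j = 0" if "r \<le> i \<or> m \<le> j" for i j
    using that r row_len[of i] by (auto simp: array_of_def)
  ultimately show "array_of P \<in> arrays r m" unfolding arrays_def by blast
  have row_sum: "(\<Sum>j<m. array_of P i j) = sum_list (P ! i)" if i: "i < length P" for i
  proof -
    have "(\<Sum>j<m. array_of P i j) = (\<Sum>j<length (P ! i). P ! i ! j)"
      using row_len[OF i] i by (intro sum.mono_neutral_cong_right) (auto simp: array_of_def)
    then show ?thesis by (simp add: sum_list_sum_nth atLeast0LessThan)
  qed
  have "array_sum r m (array_of P) = (\<Sum>i<length P. sum_list (P ! i))"
    unfolding array_sum_def using r row_sum
    by (intro sum.mono_neutral_cong_right) (auto simp: array_of_def)
  also have "\<dots> = n"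
    unfolding n[symmetric] by (simp add: sum_list_sum_nth atLeast0LessThan)
  finally show "array_sum r m (array_of P) = n" .
qed

lemma Least_zero_iff:
  fixes f :: "nat \<Rightarrow> nat"
  assumes "antimono f" "f L = 0"
  shows "i < (LEAST i. f i = 0) \<longleftrightarrow> 0 < f i"
proof
  assume "i < (LEAST i. f i = 0)"
  then show "0 < f i" using not_less_Least by blast
next
  assume pos: "0 < f i"
  show "i < (LEAST i. f i = 0)"
  proof (rule ccontr)
    assume "\<not> i < (LEAST i. f i = 0)"
    then have "f i \<le> f (LEAST i. f i = 0)" using assms(1) by (simp add: antimonoD)
    also have "\<dots> = 0" using assms(2) by (rule LeastI)
    finally show False using pos by simp
  qed
qed

lemma arrays_subset_image_array_of:
  assumes a: "a \<in> arrays r m"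
  obtains P where "plane_partition P" "length P \<le> r" "array_of P = a"
proof -
  have anti: "antimono (a i)" "antimono (\<lambda>i. a i j)" for i j
    by (intro antimonoI arrays_antimono[OF a]; simp)+
  have z: "a i m = 0" "a r j = 0" for i j
    using a by (auto simp: arrays_def)
  \<comment> \<open>\<open>c i\<close> is the length of row \<open>i\<close>, and \<open>R\<close>
    is the number of nonempty rows.\<close>
  define c where "c i = (LEAST j. a i j = 0)" for i
  define R where "R = (LEAST i. a i 0 = 0)"
  have c: "j < c i \<longleftrightarrow> 0 < a i j" for i j
    unfolding c_def by (rule Least_zero_iff[OF anti(1) z(1)])
  have R: "i < R \<longleftrightarrow> 0 < a i 0" for i
    unfolding R_def by (rule Least_zero_iff[OF anti(2) z(2)])
  have Rc: "j < c i \<Longrightarrow> i < R" for i j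
    unfolding c R using arrays_antimono[OF a, of i i 0 j] by simp
  define P where "P = map (\<lambda>i. map (a i) [0..<c i]) [0..<R]"
  have [simp]: "length P = R" by (simp add: P_def)
  have P_nth [simp]: "P ! i = map (a i) [0..<c i]" if "i < R" for i
    using that by (simp add: P_def)
  have P_set: "set P = (\<lambda>i. map (a i) [0..<c i]) ` {..<R}"
    by (auto simp: P_def)
  have c_mono: "c i' \<le> c i" if "i \<le> i'" for i i'
    using c[of "c i" i] c[of "c i" i'] arrays_antimono[OF a that, of "c i" "c i"]
    by (simp add: not_less[symmetric])
  have "plane_partition P"
    unfolding plane_partition_def
  proof (intro conjI)
    show "\<forall>row\<in>set P. row \<noteq> []"
      using c R by (auto simp: P_set)
    show "sorted_wrt (\<ge>) (map length P)"
      using c_mono by (auto simp: sorted_wrt_iff_nth_less)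
    show "\<forall>row\<in>set P. \<forall>x\<in>set row. 0 < x"
      using c by (auto simp: P_set)
    show "\<forall>row\<in>set P. sorted_wrt (\<ge>) row"
      using arrays_antimono[OF a] by (auto simp: P_set sorted_wrt_iff_nth_less)
    show "\<forall>i j. Suc i < length P \<and> j < length (P ! Suc i) \<longrightarrow> P ! Suc i ! j \<le> P ! i ! j"
    proof (intro allI impI)
      fix i j assume ij: "Suc i < length P \<and> j < length (P ! Suc i)"
      then have "j < c (Suc i)" "j < c i" using c_mono[of i "Suc i"] by auto
      then show "P ! Suc i ! j \<le> P ! i ! j"
        using ij arrays_antimono[OF a, of i "Suc i" j j] by simp
    qed
  qed
  moreover have "length P \<le> r"
    using R[of r] z(2) by (simp add: not_less[symmetric])
  moreover have "array_of P = a"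
  proof (intro ext)
    fix i j
    show "array_of P i j = a i j"
      using c[of j i] Rc[of j i] by (auto simp: array_of_def)
  qed
  ultimately show thesis using that by blast
qed

lemma bij_betw_array_of:
  assumes "n \<le> m"
  shows "bij_betw array_of (plane_partitions r n) {a \<in> arrays r m. array_sum r m a = n}"
  unfolding bij_betw_def
proof
  show "inj_on array_of (plane_partitions r n)"
    by (rule inj_on_subset[OF inj_on_array_of]) (auto simp: plane_partitions_def)
  show "array_of ` plane_partitions r n = {a \<in> arrays r m. array_sum r m a = n}"
  proof (intro equalityI subsetI)
    fix a assume "a \<in> array_of ` plane_partitions r n"
    then show "a \<in> {a \<in> arrays r m. array_sum r m a = n}"
      using array_of_in_arrays assms by auto
  next
    fix a assume a: "a \<in> {a \<in> arrays r m. array_sum r m a = n}"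
    then obtain P where P: "plane_partition P" "length P \<le> r" "array_of P = a"
      using arrays_subset_image_array_of by blast
    define k where "k = sum_list (map sum_list P)"
    have Pk: "P \<in> plane_partitions r k"
      using P by (simp add: plane_partitions_def k_def)
    \<comment> \<open>The total \<open>k\<close> of \<open>P\<close> is not yet known to be
      \<open>n\<close>. It is computed in a box of width \<open>max k m\<close>, which does not
      change the sum because \<open>a\<close> vanishes from column \<open>m\<close> on.\<close>
    have big: "array_sum r M a = array_sum r m a" if "m \<le> M" for M
      unfolding array_sum_def using a that
      by (intro sum.cong sum.mono_neutral_right) (auto simp: arrays_def)
    have "k = array_sum r (max k m) a"
      using array_of_in_arrays(2)[OF Pk, of "max k m"] P(3) by simp
    also have "\<dots> = n" using big[of "max k m"] a by simp
    finally show "a \<in> array_of ` plane_partitions r n"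
      using Pk P(3) by blast
  qed
qed

lemma pl_eq_card_arrays:
  assumes "n \<le> m"
  shows "pl r n = card {a \<in> arrays r m. array_sum r m a = n}"
  unfolding pl_def using bij_betw_same_card[OF bij_betw_array_of[OF assms]] .

section \<open>Residue classes of coefficients\<close>

text \<open>Polynomials are coefficient lists, lowest degree first. Both lists are padded to equal
  length, so \<open>map2\<close> loses nothing.\<close>

definition mult_one_minus_X :: "nat \<Rightarrow> int list \<Rightarrow> int list" where
  "mult_one_minus_X k xs = map2 (-) (xs @ replicate k 0) (replicate k 0 @ xs)"

lemma fps_mult_one_minus_X:
  "Abs_fps (nth_default 0 (mult_one_minus_X k xs)) = (1 - fps_X ^ k) * Abs_fps (nth_default 0 xs)"
proof (rule fps_ext)
  fix n
  show "Abs_fps (nth_default 0 (mult_one_minus_X k xs)) $ n =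
      ((1 - fps_X ^ k) * Abs_fps (nth_default 0 xs)) $ n"
    by (auto simp: left_diff_distrib fps_X_power_mult_nth mult_one_minus_X_def nth_default_def nth_append)
qed

text \<open>The factor \<open>1 - X ^ k\<close>, for \<open>0 < k < r\<close>, occurs once for each
  \<open>i\<close> with \<open>k <= i < r\<close>, hence \<open>r - k\<close> times.\<close>

definition numerator_list :: "nat \<Rightarrow> int list" where
  "numerator_list r = fold mult_one_minus_X (concat (map (\<lambda>i. map Suc [0..<i]) [0..<r])) [1]"

lemma fps_numerator_list:
  "Abs_fps (nth_default 0 (numerator_list r)) = (\<Prod>i<r. \<Prod>k<i. 1 - fps_X ^ Suc k)"
proof -
  have one: "Abs_fps (nth_default 0 [1]) = (1 :: int fps)"
    by (rule fps_ext) (simp add: nth_default_def)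
  have fold: "Abs_fps (nth_default 0 (fold mult_one_minus_X ks xs)) =
      (\<Prod>k\<leftarrow>ks. 1 - fps_X ^ k) * Abs_fps (nth_default 0 xs)" for ks xs
    by (induction ks arbitrary: xs) (simp_all add: fps_mult_one_minus_X mult_ac)
  have concat: "(\<Prod>k\<leftarrow>concat kss. f k) = (\<Prod>ks\<leftarrow>kss. \<Prod>k\<leftarrow>ks. f k)" for kss and f :: "nat \<Rightarrow> int fps"
    by (induction kss) simp_all
  show ?thesis
    unfolding numerator_list_def fold concat one
    by (simp add: o_def prod.distinct_set_conv_list[symmetric] atLeast0LessThan)
qed

text \<open>The list is cut into blocks as long as \<open>cs\<close>; \<open>x\<close> is already
  removed, hence the \<open>- 1\<close> in \<open>drop\<close>. In a short last block
  \<open>map2\<close> treats the missing coefficients as 0.\<close>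

fun check_residues :: "int \<Rightarrow> int list \<Rightarrow> int list \<Rightarrow> bool" where
  "check_residues p cs [] = True"
| "check_residues p cs (x # xs) =
    (p dvd sum_list (map2 (*) cs (x # xs)) \<and> check_residues p cs (drop (length cs - 1) xs))"

lemma sum_list_map2_mult:
  "sum_list (map2 (*) cs xs) = (\<Sum>j<length cs. cs ! j * nth_default 0 xs j)" for xs :: "int list"
proof -
  have "sum_list (map2 (*) cs xs) = (\<Sum>j<min (length cs) (length xs). cs ! j * xs ! j)"
    by (simp add: sum_list_sum_nth atLeast0LessThan)
  also have "\<dots> = (\<Sum>j<length cs. cs ! j * nth_default 0 xs j)"
    by (intro sum.mono_neutral_cong_left) (auto simp: nth_default_def)
  finally show ?thesis .
qed

lemma check_residuesD:
  assumes "check_residues p cs xs" "cs \<noteq> []"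
  shows "p dvd (\<Sum>j<length cs. cs ! j * nth_default 0 xs (length cs * n + j))"
  using assms
proof (induction p cs xs arbitrary: n rule: check_residues.induct)
  case (1 p cs)
  then show ?case by (simp add: nth_default_def)
next
  case (2 p cs x xs)
  show ?case
  proof (cases n)
    case 0
    then show ?thesis using 2 by (simp add: sum_list_map2_mult)
  next
    case (Suc n')
    obtain l where l: "length cs = Suc l" using 2(3) by (cases cs) auto
    have "nth_default 0 (x # xs) (length cs * n + j) =
        nth_default 0 (drop (length cs - 1) xs) (length cs * n' + j)" for j
      by (auto simp: nth_default_def l Suc algebra_simps)
    then show ?thesis using 2 by simp
  qed
qed

section \<open>Series in \<open>X ^ d\<close> modulo \<open>p\<close>\<close>

definition supported_mod :: "int \<Rightarrow> nat \<Rightarrow> int fps \<Rightarrow> bool" where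
  "supported_mod p d f \<longleftrightarrow> (\<forall>k. \<not> d dvd k \<longrightarrow> p dvd f $ k)"

lemma supported_mod_mult:
  assumes "supported_mod p d f" "supported_mod p d g"
  shows "supported_mod p d (f * g)"
  unfolding supported_mod_def fps_mult_nth
proof (intro allI impI dvd_sum)
  fix k i assume k: "\<not> d dvd k" and i: "i \<in> {0..k}"
  have "\<not> d dvd i \<or> \<not> d dvd (k - i)"
    using k i by (metis atLeastAtMost_iff dvd_add le_add_diff_inverse)
  then show "p dvd f $ i * g $ (k - i)"
    using assms by (auto simp: supported_mod_def)
qed

lemma supported_mod_prod:
  assumes "\<And>i. i \<in> A \<Longrightarrow> supported_mod p d (f i)"
  shows "supported_mod p d (\<Prod>i\<in>A. f i)"
  using assms
proof (induction A rule: infinite_finite_induct)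
  case (insert i A)
  then show ?case by (simp add: supported_mod_mult)
qed (auto simp: supported_mod_def intro: gr0I)

text \<open>In the binomial expansion only \<open>j = 0\<close> and \<open>j = d\<close> survive
  modulo \<open>p\<close>, and their exponents are multiples of \<open>d\<close>.\<close>

lemma supported_mod_power:
  assumes "\<And>j. 0 < j \<Longrightarrow> j < d \<Longrightarrow> p dvd int (d choose j)"
  shows "supported_mod p d ((1 - fps_X ^ k) ^ d)"
  unfolding supported_mod_def
proof (intro allI impI)
  fix l assume l: "\<not> d dvd l"
  have "((1 - fps_X ^ k :: int fps) ^ d) = (- (fps_X ^ k) + 1) ^ d" by simp
  also have "\<dots> = (\<Sum>j\<le>d. fps_const (int (d choose j) * (- 1) ^ j) * fps_X ^ (k * j))"
    unfolding binomial_ring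
  proof (intro sum.cong refl)
    fix j
    have "(- (fps_X ^ k)) ^ j = (fps_const ((- 1) ^ j) * fps_X ^ (k * j) :: int fps)"
      unfolding power_minus[of "fps_X ^ k"] power_mult[symmetric]
      by (simp add: fps_const_power[symmetric] fps_const_neg[symmetric])
    then show "of_nat (d choose j) * (- (fps_X ^ k)) ^ j * 1 ^ (d - j) =
        (fps_const (int (d choose j) * (- 1) ^ j) * fps_X ^ (k * j) :: int fps)"
      by (simp add: fps_of_nat[symmetric] mult.assoc[symmetric])
  qed
  finally have "((1 - fps_X ^ k :: int fps) ^ d) $ l =
      (\<Sum>j\<le>d. int (d choose j) * (- 1) ^ j * (if l = k * j then 1 else 0))"
    by (simp add: fps_sum_nth fps_X_power_nth)
  also have "p dvd \<dots>"
  proof (rule dvd_sum)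
    fix j assume j: "j \<in> {..d}"
    show "p dvd int (d choose j) * (- 1) ^ j * (if l = k * j then 1 else 0)"
    proof (cases "0 < j \<and> j < d")
      case False
      then have "j = 0 \<or> j = d" using j by auto
      then have "l \<noteq> k * j" using l by auto
      then show ?thesis by simp
    qed (use assms in simp)
  qed
  finally show "p dvd ((1 - fps_X ^ k) ^ d) $ l" .
qed

text \<open>Modulo \<open>p\<close>, multiplication by \<open>U\<close> preserves residue classes
  modulo \<open>r\<close>. A linear relation between the classes of \<open>N\<close> thus says that
  \<open>U\<close> convolved with the same combination for \<open>F\<close> vanishes; since
  \<open>U $ 0 = 1\<close>, this is solved by induction on \<open>n\<close>. The bound
  \<open>m\<close> allows for a truncated product as \<open>U\<close>.\<close>

lemma residue_class_transfer:
  fixes U F N :: "int fps" and c :: "nat \<Rightarrow> int"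
  assumes U: "supported_mod p r U" "U $ 0 = 1" and r: "0 < r"
    and UF: "\<And>k. k \<le> m \<Longrightarrow> (U * F) $ k = N $ k"
    and N: "\<And>n. p dvd (\<Sum>j<r. c j * N $ (r * n + j))"
    and n: "r * n + r \<le> m"
  shows "p dvd (\<Sum>j<r. c j * F $ (r * n + j))"
  using n
proof (induction n rule: less_induct)
  case (less n)
  let ?S = "\<lambda>n. \<Sum>j<r. c j * F $ (r * n + j)"
  \<comment> \<open>In the coefficient of \<open>U * F\<close>, indices not divisible by
    \<open>r\<close> contribute multiples of \<open>p\<close>; the others are
    \<open>r * t\<close>.\<close>
  have *: "p dvd N $ (r * n + j) - (\<Sum>t\<le>n. U $ (r * t) * F $ (r * (n - t) + j))" if j: "j < r" for j
  proof -
    let ?A = "{i \<in> {0..r * n + j}. r dvd i}" and ?B = "{i \<in> {0..r * n + j}. \<not> r dvd i}"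
    let ?g = "\<lambda>i. U $ i * F $ (r * n + j - i)"
    have "N $ (r * n + j) = sum ?g {0..r * n + j}"
      using UF[of "r * n + j"] less.prems j by (simp add: fps_mult_nth)
    also have "{0..r * n + j} = ?A \<union> ?B" by auto
    also have "sum ?g (?A \<union> ?B) = sum ?g ?A + sum ?g ?B"
      by (rule sum.union_disjoint) auto
    also have "sum ?g ?A = (\<Sum>t\<le>n. U $ (r * t) * F $ (r * (n - t) + j))"
    proof (rule sum.reindex_bij_witness[where i = "\<lambda>t. r * t" and j = "\<lambda>i. i div r"])
      fix i assume i: "i \<in> ?A"
      then obtain t where t: "i = r * t" by auto
      have "r * t < r * Suc n" using i t j by simp
      then have tn: "t \<le> n" unfolding mult_less_cancel1 less_Suc_eq_le by blast
      then show "i div r \<in> {..n}" using t r by simp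
      show "r * (i div r) = i" using t r by simp
      have "r * n + j - r * t = r * (n - t) + j"
        using tn by (simp add: diff_mult_distrib2)
      then show "U $ (r * (i div r)) * F $ (r * (n - i div r) + j) = ?g i" using t r by simp
    qed (use r in \<open>auto intro: trans_le_add1\<close>)
    finally have "N $ (r * n + j) - (\<Sum>t\<le>n. U $ (r * t) * F $ (r * (n - t) + j)) = sum ?g ?B"
      by simp
    also have "p dvd \<dots>"
      using U(1) by (intro dvd_sum) (auto simp: supported_mod_def)
    finally show ?thesis .
  qed
  have "p dvd (\<Sum>j<r. c j * (N $ (r * n + j) - (\<Sum>t\<le>n. U $ (r * t) * F $ (r * (n - t) + j))))"
    using * by (intro dvd_sum) simp
  also have "\<dots> = (\<Sum>j<r. c j * N $ (r * n + j)) - (\<Sum>t\<le>n. U $ (r * t) * ?S (n - t))"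
  proof -
    have "(\<Sum>j<r. c j * (\<Sum>t\<le>n. U $ (r * t) * F $ (r * (n - t) + j))) =
        (\<Sum>t\<le>n. U $ (r * t) * ?S (n - t))"
      unfolding sum_distrib_left by (subst sum.swap) (simp only: mult.left_commute)
    then show ?thesis by (simp add: right_diff_distrib sum_subtractf)
  qed
  finally have "p dvd (\<Sum>t\<le>n. U $ (r * t) * ?S (n - t))"
    using N[of n] by (simp add: dvd_diff_right_iff)
  also have "(\<Sum>t\<le>n. U $ (r * t) * ?S (n - t)) = ?S n + (\<Sum>t<n. U $ (r * Suc t) * ?S (n - Suc t))"
    by (subst sum.atMost_shift) (simp add: U(2))
  finally have "p dvd ?S n + (\<Sum>t<n. U $ (r * Suc t) * ?S (n - Suc t))" .
  moreover have "p dvd (\<Sum>t<n. U $ (r * Suc t) * ?S (n - Suc t))"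
  proof (rule dvd_sum, rule dvd_mult)
    fix t assume t: "t \<in> {..<n}"
    have "r * (n - Suc t) + r \<le> r * n + r"
      by (intro add_right_mono mult_le_mono2 diff_le_self)
    then have "r * (n - Suc t) + r \<le> m" using less.prems by (rule order_trans)
    then show "p dvd ?S (n - Suc t)"
      using t by (intro less.IH) auto
  qed
  ultimately show ?case by (simp add: dvd_add_left_iff)
qed

section \<open>The generating function of \<open>pl r\<close> up to a given degree\<close>

lemma prod_low_coeffs:
  fixes f :: "'b \<Rightarrow> int fps"
  assumes "\<And>i. i \<in> A \<Longrightarrow> f i $ 0 = 1 \<and> (\<forall>j. 0 < j \<and> j \<le> m \<longrightarrow> f i $ j = 0)"
  shows "(\<Prod>i\<in>A. f i) $ 0 = 1 \<and> (\<forall>j. 0 < j \<and> j \<le> m \<longrightarrow> (\<Prod>i\<in>A. f i) $ j = 0)"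
  using assms
proof (induction A rule: infinite_finite_induct)
  case (insert i A)
  let ?P = "\<Prod>i\<in>A. f i"
  have IH: "?P $ 0 = 1" "\<And>j. 0 < j \<Longrightarrow> j \<le> m \<Longrightarrow> ?P $ j = 0"
    using insert by auto
  have f: "f i $ 0 = 1" "\<And>j. 0 < j \<Longrightarrow> j \<le> m \<Longrightarrow> f i $ j = 0"
    using insert.prems by auto
  have "(f i * ?P) $ j = 0" if j: "0 < j" "j \<le> m" for j
    unfolding fps_mult_nth
  proof (intro sum.neutral ballI)
    fix l assume "l \<in> {0..j}"
    then show "f i $ l * ?P $ (j - l) = 0"
      using IH(2)[of "j - l"] f(2)[of l] j by (cases "l = 0") auto
  qed
  then show ?case using insert.hyps IH(1) f(1) by simp
qed auto

lemma prod_lessThan_add: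
  fixes g :: "nat \<Rightarrow> 'a::comm_monoid_mult"
  shows "(\<Prod>k<i. g k) * (\<Prod>j<m. g (i + j)) = (\<Prod>k<i + m. g k)"
  by (induction m) (simp_all add: mult.assoc[symmetric])

text \<open>For each \<open>i\<close>, the factors \<open>g i\<close> to
  \<open>g (i + m - 1)\<close> of MacMahon's product are completed to all \<open>g k\<close> with
  \<open>k < m + r\<close>. The missing lower factors form the numerator. The missing upper ones
  form \<open>C\<close>, which is 1 up to degree \<open>m\<close>. This avoids infinite
  products.\<close>

lemma pl_generating_function_truncated:
  fixes r m :: nat
  defines "g \<equiv> \<lambda>k. 1 - fps_X ^ Suc k :: int fps"
  assumes "k \<le> m"
  shows "((\<Prod>k<m + r. g k) ^ r * Abs_fps (\<lambda>n. int (pl r n))) $ k = (\<Prod>i<r. \<Prod>k<i. g k) $ k"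
proof -
  let ?F = "Abs_fps (\<lambda>n. int (pl r n))"
  let ?A = "Abs_fps (\<lambda>n. int (card {a \<in> arrays r m. array_sum r m a = n}))"
  let ?N = "\<Prod>i<r. \<Prod>k<i. g k"
  define C where "C = (\<Prod>i<r. \<Prod>j<r - i. g (i + m + j))"
  have "(\<Prod>i<r. \<Prod>j<m. g (i + j)) * ?A = 1"
    using arrays_generating_function[where m = m and r = r and 'a = int]
    by (subst prod.swap) (simp add: g_def)
  moreover have "(\<Prod>k<m + r. g k) ^ r = ?N * (\<Prod>i<r. \<Prod>j<m. g (i + j)) * C"
  proof -
    have "(\<Prod>k<i. g k) * (\<Prod>j<m. g (i + j)) * (\<Prod>j<r - i. g (i + m + j)) = (\<Prod>k<m + r. g k)"
      if "i < r" for i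
      unfolding prod_lessThan_add using that by (intro prod.cong) auto
    then have "(\<Prod>i<r. (\<Prod>k<i. g k) * (\<Prod>j<m. g (i + j)) * (\<Prod>j<r - i. g (i + m + j))) =
        (\<Prod>k<m + r. g k) ^ r"
      by simp
    then show ?thesis by (simp add: prod.distrib C_def)
  qed
  ultimately have EA: "(\<Prod>k<m + r. g k) ^ r * ?A = ?N * C"
    by (metis (no_types, lifting) mult.assoc mult.commute mult_1)
  have "g (i + m + j) $ 0 = 1 \<and> (\<forall>l. 0 < l \<and> l \<le> m \<longrightarrow> g (i + m + j) $ l = 0)" for i j
    by (auto simp: g_def fps_X_power_nth simp del: power_Suc)
  then have C: "C $ 0 = 1 \<and> (\<forall>j. 0 < j \<and> j \<le> m \<longrightarrow> C $ j = 0)"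
    unfolding C_def by (intro prod_low_coeffs)
  \<comment> \<open>Up to degree \<open>m\<close>, counting arrays with \<open>m\<close> columns
    agrees with \<open>pl r\<close>.\<close>
  have "((\<Prod>k<m + r. g k) ^ r * ?F) $ k = ((\<Prod>k<m + r. g k) ^ r * ?A) $ k"
    unfolding fps_mult_nth using assms(2) by (intro sum.cong) (auto simp: pl_eq_card_arrays)
  also have "\<dots> = (\<Sum>i=0..k. ?N $ i * C $ (k - i))"
    unfolding EA fps_mult_nth ..
  also have "\<dots> = (\<Sum>i=0..k. if i = k then ?N $ k else 0)"
    using C assms(2) by (intro sum.cong) auto
  also have "\<dots> = ?N $ k" by simp
  finally show ?thesis .
qed

text \<open>A finite check on the numerator yields the relation for every \<open>n\<close>; the
  truncation degree is chosen according to \<open>n\<close>.\<close>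

lemma pl_residue_classes:
  assumes "0 < r" "length cs = r" "check_residues p cs (numerator_list r)"
    and choose: "\<And>j. 0 < j \<Longrightarrow> j < r \<Longrightarrow> p dvd int (r choose j)"
  shows "p dvd (\<Sum>j<r. cs ! j * int (pl r (r * n + j)))"
proof -
  define m where "m = r * n + r"
  let ?g = "\<lambda>k. 1 - fps_X ^ Suc k :: int fps"
  let ?U = "\<Prod>k<m + r. ?g k ^ r"
  have "p dvd (\<Sum>j<r. cs ! j * Abs_fps (\<lambda>n. int (pl r n)) $ (r * n + j))"
  proof (rule residue_class_transfer[where U = ?U and m = m and N = "\<Prod>i<r. \<Prod>k<i. ?g k"])
    show "supported_mod p r ?U"
      by (intro supported_mod_prod supported_mod_power choose)
    show "?U $ 0 = 1"
      by (rule prod_low_coeffs[where m = 0, THEN conjunct1]) (auto simp: fps_power_zeroth)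
    show "(?U * Abs_fps (\<lambda>n. int (pl r n))) $ k = (\<Prod>i<r. \<Prod>k<i. ?g k) $ k" if "k \<le> m" for k
      using pl_generating_function_truncated[OF that, of r] by (simp only: prod_power_distrib)
    show "p dvd (\<Sum>j<r. cs ! j * (\<Prod>i<r. \<Prod>k<i. ?g k) $ (r * n + j))" for n
      unfolding fps_numerator_list[symmetric] fps_nth_Abs_fps
      using check_residuesD[OF assms(3), of n] assms(1,2) by auto
  qed (use assms in \<open>auto simp: m_def\<close>)
  then show ?thesis by simp
qed

text \<open>Position \<open>j\<close> holds the coefficient of the residue class of
  \<open>j\<close>. For the classes 5, 6 and 7 modulo 8, vanishing is checked separately.\<close>

lemma check_numerators:
  "check_residues 2 [0, 0, 0, 1] (numerator_list 4)"
  "check_residues 2 [1, -1, 0, 0] (numerator_list 4)"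
  "check_residues 2 [0, 1, -1, 0] (numerator_list 4)"
  "check_residues 2 [1, 1, 0, -1, 0, 0, 0, 0] (numerator_list 8)"
  "check_residues 2 [0, 0, 0, 0, 0, 1, 0, 0] (numerator_list 8)"
  "check_residues 2 [0, 0, 0, 0, 0, 0, 1, 0] (numerator_list 8)"
  "check_residues 2 [0, 0, 0, 0, 0, 0, 0, 1] (numerator_list 8)"
  "check_residues 3 [0, 1, 0, 0, 0, 0, 0, 0, -1] (numerator_list 9)"
  by code_simp+

lemma dvd_choose:
  "\<forall>j\<in>{0<..<4}. 2 dvd int (4 choose j)"
  "\<forall>j\<in>{0<..<8}. 2 dvd int (8 choose j)"
  "\<forall>j\<in>{0<..<9}. 3 dvd int (9 choose j)"
  by code_simp+

theorem theorem3p1: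
  fixes n :: nat
  shows "[pl 4 (4 * n + 3) = 0] (mod 2) \<and>
    ([pl 4 (4 * n) = pl 4 (4 * n + 1)] (mod 2) \<and>
     [pl 4 (4 * n + 1) = pl 4 (4 * n + 2)] (mod 2)) \<and>
    [pl 8 (8 * n) + pl 8 (8 * n + 1) = pl 8 (8 * n + 3)] (mod 2) \<and>
    ([pl 8 (8 * n + 5) = pl 8 (8 * n + 6)] (mod 2) \<and>
     [pl 8 (8 * n + 6) = pl 8 (8 * n + 7)] (mod 2) \<and>
     [pl 8 (8 * n + 7) = 0] (mod 2)) \<and>
    [pl 9 (9 * n + 1) = pl 9 (9 * n + 8)] (mod 3)"
proof -
  have classes: "p dvd (\<Sum>j<r. cs ! j * int (pl r (r * n + j)))"
    if "check_residues p cs (numerator_list r)" "\<forall>j\<in>{0<..<r}. p dvd int (r choose j)" "length cs = r" "0 < r"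
    for p r cs
    using that by (intro pl_residue_classes) auto
  note sums = lessThan_nat_numeral lessThan_Suc nth_Cons_numeral
  note dvds = classes[OF check_numerators(1) dvd_choose(1)] classes[OF check_numerators(2) dvd_choose(1)]
    classes[OF check_numerators(3) dvd_choose(1)] classes[OF check_numerators(4) dvd_choose(2)]
    classes[OF check_numerators(5) dvd_choose(2)] classes[OF check_numerators(6) dvd_choose(2)]
    classes[OF check_numerators(7) dvd_choose(2)] classes[OF check_numerators(8) dvd_choose(3)]
  \<comment> \<open>Passing to integer divisibility allows the negative coefficients in the
    lists.\<close>
  have cong: "[a = b] (mod k) \<longleftrightarrow> int k dvd int a - int b" for a b k :: nat
    unfolding cong_int_iff[symmetric] cong_iff_dvd_diff ..
  have "(2::int) dvd int (pl 4 (4 * n + 3))"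
    "(2::int) dvd int (pl 4 (4 * n)) - int (pl 4 (4 * n + 1))"
    "(2::int) dvd int (pl 4 (4 * n + 1)) - int (pl 4 (4 * n + 2))"
    "(2::int) dvd int (pl 8 (8 * n)) + int (pl 8 (8 * n + 1)) - int (pl 8 (8 * n + 3))"
    "(2::int) dvd int (pl 8 (8 * n + 5))"
    "(2::int) dvd int (pl 8 (8 * n + 6))"
    "(2::int) dvd int (pl 8 (8 * n + 7))"
    "(3::int) dvd int (pl 9 (9 * n + 1)) - int (pl 9 (9 * n + 8))"
    using dvds by (simp_all add: sums) argo
  then show ?thesis
    unfolding cong of_nat_add of_nat_numeral of_nat_0 diff_0_right by (blast intro: dvd_diff)
qed

end
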